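(* Consider the problem data, the barrier problem (BP) and the DFM iteration described in the context, started at a point $\mathbf{x}^0$ feasible for (BP). Suppose that Assumption 1 and Assumption 2 (both stated in the context) hold, and let $\underline{f}\le f^\star$. For any $0<\epsilon<2(f(\mathbf{x}^0)-f^\star)$, run DFM with $$\rho=\frac{\epsilon^2}{4(f(\mathbf{x}^0)-\underline{f})B(\mathbf{x}^0)}$$ and let $k_\epsilon$ be the smallest $k\ge 0$ satisfying $f(\mathbf{x}^k)-f^\star\le 2\epsilon$. Then: (1) if each $f_i$ is convex and the set $\mathcal{C}:=\{\mathbf{x}:\mathbf{x}\text{ is feasible for (BP) and }F(\mathbf{x})\le F(\mathbf{x}^0)\}$ is compact, then $k_\epsilon=O\!\left(\frac{1}{\epsilon^5\lambda_W}\right)$; (2) if each $f_i$ is $\sigma$-strongly convex for some $\sigma>0$, then $k_\epsilon=O\!\left(\frac{1}{\sigma\lambda_W\epsilon^4}\ln\frac{1}{\epsilon}\right)$. Here $\lambda_W$ is the smallest nonzero eigenvalue of $W$, and $O(\cdot)$ is understood as $\epsilon\to 0$ with the problem data, the graph, $\mathbf{x}^0$ and $\underline{f}$ fixed.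
   Context: **Problem.** $\mathcal{G}=(\mathcal{V},\mathcal{E})$ is an undirected graph with $\mathcal{V}=\{1,\dots,n\}$; $\mathcal{N}_i=\{j:\{i,j\}\in\mathcal{E}\}$ and $\bar{\mathcal{N}}_i=\mathcal{N}_i\cup\{i\}$. For each $i\in\mathcal{V}$ there are a function $f_i:\mathbb{R}^{d_i}\to\mathbb{R}$, a set $\mathcal{X}_i\subset\mathbb{R}^{d_i}$ and a matrix $A_i\in\mathbb{R}^{m\times d_i}$; $c\in\mathbb{R}^m$. Write $N=\sum_i d_i$, $\mathbf{x}=[x_1^T,\dots,x_n^T]^T\in\mathbb{R}^N$, $A=[A_1,\dots,A_n]$, $f(\mathbf{x})=\sum_i f_i(x_i)$. The original problem is (P) minimize $\sum_{i\in\mathcal{V}}f_i(x_i)$ subject to $x_i\in\mathcal{X}_i$ for all $i$ and $\sum_{i\in\mathcal{V}}A_ix_i=c$, with optimal value $f^\star$. **Assumption 1.** (a) Each $f_i$ is $L_i$-smooth for some $L_i>0$, i.e. differentiable with $L_i$-Lipschitz gradient on $\mathbb{R}^{d_i}$. (b) $\mathcal{X}_i=\{x\in\mathbb{R}^{d_i}:g_i^j(x)\le 0,\ j=1,\dots,q_i\}$ for convex, $\beta$-smooth functions $g_i^j:\mathbb{R}^{d_i}\to\mathbb{R}$ (differentiable, with $\beta$-Lipschitz gradient on $\mathbb{R}^{d_i}$), and each $g_i^j$ is $\beta_1$-Lipschitz continuous on $\mathcal{X}_i$. (c) There exist $\{\tilde{x}_i\}_{i\in\mathcal{V}}$ with $\sum_iA_i\tilde{x}_i=c$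 and $g_i^j(\tilde{x}_i)<0$ for all $i$ and $j=1,\dots,q_i$. (d) $f^\star>-\infty$. **Assumption 2 (reachability).** For $i\in\mathcal{V}$ let $\mathcal{S}_i=\{\mathbf{u}=[u_1^T,\dots,u_n^T]^T\in\mathbb{R}^N: u_j\in\mathbb{R}^{d_j},\ u_j=\mathbf{0}\ \forall j\notin\bar{\mathcal{N}}_i,\ \sum_{j\in\bar{\mathcal{N}}_i}A_ju_j=\mathbf{0}\}$. Then $\mathcal{S}_1+\dots+\mathcal{S}_n=\operatorname{Null}(A)$ (Minkowski sum). **Barrier problem.** For $\rho>0$, let $\tilde{\mathcal{X}}_i=\{x_i\in\mathbb{R}^{d_i}:g_i^j(x_i)<0,\ j=1,\dots,q_i\}$, $\tilde{\mathcal{X}}=\tilde{\mathcal{X}}_1\times\dots\times\tilde{\mathcal{X}}_n$, $B_i(x_i)=-\sum_{j=1}^{q_i}1/g_i^j(x_i)$ for $x_i\in\tilde{\mathcal{X}}_i$, $B(\mathbf{x})=\sum_iB_i(x_i)$, $F(\mathbf{x})=f(\mathbf{x})+\rho B(\mathbf{x})$ (so $F$ depends on $\rho$). (BP) minimize $F(\mathbf{x})$ subject to $\mathbf{x}\in\tilde{\mathcal{X}}$, $A\mathbf{x}=c$. (Its feasible set does not depend on $\rho$.) **DFM algorithm.** Start from $\mathbf{x}^0$ feasible for (BP). Let $\eta_j=1/\max_{\ell\in\bar{\mathcal{N}}_j}|\bar{\mathcal{N}}_\ell|$. At iteration $k\ge 0$ let $f_i^k(x_i)=f_i(x_i^k)+\langle\nabla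 f_i(x_i^k),x_i-x_i^k\rangle+\frac{L_i}{2}\|x_i-x_i^k\|^2$. Each node $i$ computes $\{p_{ij}^k\}_{j\in\bar{\mathcal{N}}_i}$, the optimal solution of: minimize over $p_{ij}\in\mathbb{R}^{d_j}$, $j\in\bar{\mathcal{N}}_i$, the function $\sum_{j\in\bar{\mathcal{N}}_i}\big(f_j^k(x_j^k+p_{ij})+\rho B_j(x_j^k+p_{ij})\big)$ subject to $\sum_{j\in\bar{\mathcal{N}}_i}A_jp_{ij}=\mathbf{0}$ and $x_j^k+p_{ij}\in\tilde{\mathcal{X}}_j$ for all $j\in\bar{\mathcal{N}}_i$. Then $x_i^{k+1}=x_i^k+\sum_{j\in\bar{\mathcal{N}}_i}\eta_jp_{ji}^k$, and $\mathbf{x}^k=[(x_1^k)^T,\dots,(x_n^k)^T]^T$. **Other notation.** $P_i\in\mathbb{R}^{N\times N}$ is the orthogonal projection matrix onto $\mathcal{S}_i$ and $W=\sum_{i\in\mathcal{V}}\eta_iP_i$. A function $h:\mathbb{R}^d\to\mathbb{R}$ is $\sigma$-strongly convex if $h(y)-h(x)\ge\langle g_x,y-x\rangle+\frac{\sigma}{2}\|x-y\|^2$ for all $x,y$ and all $g_x\in\partial h(x)$. *)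

theory Defs
  imports "HOL-Analysis.Analysis" "HOL-Library.Landau_Symbols"
begin

text \<open>
  The nodes are the elements of a finite type \<open>'v\<close>, the coordinates of \<open>\<real>\<^sup>N\<close> the elements of a
  finite type \<open>'n\<close>, and \<open>owner\<close> maps a coordinate to the node it belongs to.  So \<open>d\<^sub>i\<close> is the number
  of coordinates owned by \<open>i\<close>, and \<open>\<real>\<^bsup>d\<^sub>i\<^esup>\<close> is the coordinate subspace of the vectors supported on
  those coordinates.  Every tuple of dimensions arises in this way.  The functions \<open>loc_obj i\<close>
  (\<open>f\<^sub>i\<close>) and \<open>constr i j\<close> (\<open>g\<^sub>i\<^sup>j\<close>) matter only on that subspace.  \<open>coeff\<close> is the
  whole matrix \<open>A = [A\<^sub>1, \<dots>, A\<^sub>n]\<close>; for \<open>u\<close> in the \<open>i\<close>-th subspace, \<open>coeff *v u\<close> is \<open>A\<^sub>i u\<close>.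
\<close>

record ('v, 'n, 'm) network_problem =
  edges :: "'v set set"
  owner :: "'n \<Rightarrow> 'v"
  loc_obj :: "'v \<Rightarrow> real ^ 'n \<Rightarrow> real"
  n_constr :: "'v \<Rightarrow> nat"
  constr :: "'v \<Rightarrow> nat \<Rightarrow> real ^ 'n \<Rightarrow> real"
  coeff :: "real ^ 'n ^ 'm"
  rhs :: "real ^ 'm"

definition undirected_graph :: "('v, 'n::finite, 'm::finite) network_problem \<Rightarrow> bool" where
  "undirected_graph P \<longleftrightarrow> (\<forall>e\<in>edges P. \<exists>i j. e = {i, j})"

definition nbhd :: "('v, 'n::finite, 'm::finite) network_problem \<Rightarrow> 'v \<Rightarrow> 'v set" where
  "nbhd P i = {j. {i, j} \<in> edges P}"

definition closed_nbhd :: "('v, 'n::finite, 'm::finite) network_problem \<Rightarrow> 'v \<Rightarrow> 'v set" where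
  "closed_nbhd P i = insert i (nbhd P i)"

definition block_space :: "('v, 'n::finite, 'm::finite) network_problem \<Rightarrow> 'v \<Rightarrow> (real ^ 'n) set" where
  "block_space P i = {x. \<forall>k. owner P k \<noteq> i \<longrightarrow> x $ k = 0}"

definition block :: "('v, 'n::finite, 'm::finite) network_problem \<Rightarrow> 'v \<Rightarrow> real ^ 'n \<Rightarrow> real ^ 'n" where
  "block P i x = (\<chi> k. if owner P k = i then x $ k else 0)"


section \<open>Smoothness and strong convexity on a linear subspace\<close>

definition grad_on :: "'a::euclidean_space set \<Rightarrow> ('a \<Rightarrow> real) \<Rightarrow> 'a \<Rightarrow> 'a" where
  "grad_on E h x = (THE v. v \<in> E \<and> (h has_derivative (\<lambda>u. v \<bullet> u)) (at x within E))"

definition smooth_fun_on :: "'a::euclidean_space set \<Rightarrow> real \<Rightarrow> ('a \<Rightarrow> real) \<Rightarrow> bool" where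
  "smooth_fun_on E L h \<longleftrightarrow> h differentiable_on E \<and> L-lipschitz_on E (grad_on E h)"

definition subdifferential_on :: "'a::euclidean_space set \<Rightarrow> ('a \<Rightarrow> real) \<Rightarrow> 'a \<Rightarrow> 'a set" where
  "subdifferential_on E h x = {v \<in> E. \<forall>y\<in>E. h y - h x \<ge> v \<bullet> (y - x)}"

text \<open>
  The subdifferential presupposes convexity: for a nonconvex function it may be empty everywhere,
  and the inequality alone would hold vacuously.
\<close>

definition strongly_convex_on :: "'a::euclidean_space set \<Rightarrow> real \<Rightarrow> ('a \<Rightarrow> real) \<Rightarrow> bool" where
  "strongly_convex_on E \<sigma> h \<longleftrightarrow> convex_on E h \<and>
     (\<forall>x\<in>E. \<forall>y\<in>E. \<forall>v\<in>subdifferential_on E h x.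
        h y - h x \<ge> v \<bullet> (y - x) + \<sigma> / 2 * (norm (x - y))\<^sup>2)"


section \<open>The constrained problem and the assumptions\<close>

definition objective :: "('v::finite, 'n::finite, 'm::finite) network_problem \<Rightarrow> real ^ 'n \<Rightarrow> real" where
  "objective P x = (\<Sum>i\<in>UNIV. loc_obj P i (block P i x))"

definition loc_set :: "('v, 'n::finite, 'm::finite) network_problem \<Rightarrow> 'v \<Rightarrow> (real ^ 'n) set" where
  "loc_set P i = {x \<in> block_space P i. \<forall>j\<in>{1..n_constr P i}. constr P i j x \<le> 0}"

definition loc_set_strict :: "('v, 'n::finite, 'm::finite) network_problem \<Rightarrow> 'v \<Rightarrow> (real ^ 'n) set" where
  "loc_set_strict P i = {x \<in> block_space P i. \<forall>j\<in>{1..n_constr P i}. constr P i j x < 0}"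

definition feasible :: "('v::finite, 'n::finite, 'm::finite) network_problem \<Rightarrow> (real ^ 'n) set" where
  "feasible P = {x. (\<forall>i. block P i x \<in> loc_set P i) \<and>
     (\<Sum>i\<in>UNIV. coeff P *v block P i x) = rhs P}"

definition opt_value :: "('v::finite, 'n::finite, 'm::finite) network_problem \<Rightarrow> real" where
  "opt_value P = (INF x\<in>feasible P. objective P x)"

definition assumption1 ::
  "('v::finite, 'n::finite, 'm::finite) network_problem \<Rightarrow> ('v \<Rightarrow> real) \<Rightarrow> real \<Rightarrow> real \<Rightarrow> bool" where
  "assumption1 P L \<beta> \<beta>\<^sub>1 \<longleftrightarrow>
     (\<forall>i. L i > 0 \<and> smooth_fun_on (block_space P i) (L i) (loc_obj P i)) \<and>
     (\<forall>i. \<forall>j\<in>{1..n_constr P i}.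
        convex_on (block_space P i) (constr P i j) \<and>
        smooth_fun_on (block_space P i) \<beta> (constr P i j) \<and>
        \<beta>\<^sub>1-lipschitz_on (loc_set P i) (constr P i j)) \<and>
     (\<exists>x. (\<Sum>i\<in>UNIV. coeff P *v block P i x) = rhs P \<and>
        (\<forall>i. \<forall>j\<in>{1..n_constr P i}. constr P i j (block P i x) < 0)) \<and>
     bdd_below (objective P ` feasible P)"

definition reach_space :: "('v, 'n::finite, 'm::finite) network_problem \<Rightarrow> 'v \<Rightarrow> (real ^ 'n) set" where
  "reach_space P i = {u. (\<forall>j. j \<notin> closed_nbhd P i \<longrightarrow> block P j u = 0) \<and>
     (\<Sum>j\<in>closed_nbhd P i. coeff P *v block P j u) = 0}"

definition assumption2 :: "('v::finite, 'n::finite, 'm::finite) network_problem \<Rightarrow> bool" where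
  "assumption2 P \<longleftrightarrow>
     {(\<Sum>i\<in>UNIV. u i) | u. \<forall>i. u i \<in> reach_space P i} = {x. coeff P *v x = 0}"


section \<open>The barrier problem\<close>

definition loc_barrier :: "('v, 'n::finite, 'm::finite) network_problem \<Rightarrow> 'v \<Rightarrow> real ^ 'n \<Rightarrow> real" where
  "loc_barrier P i x = - (\<Sum>j=1..n_constr P i. 1 / constr P i j x)"

definition barrier :: "('v::finite, 'n::finite, 'm::finite) network_problem \<Rightarrow> real ^ 'n \<Rightarrow> real" where
  "barrier P x = (\<Sum>i\<in>UNIV. loc_barrier P i (block P i x))"

definition bar_objective ::
  "('v::finite, 'n::finite, 'm::finite) network_problem \<Rightarrow> real \<Rightarrow> real ^ 'n \<Rightarrow> real" where
  "bar_objective P \<rho> x = objective P x + \<rho> * barrier P x"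

definition bar_feasible :: "('v, 'n::finite, 'm::finite) network_problem \<Rightarrow> (real ^ 'n) set" where
  "bar_feasible P = {x. (\<forall>i. block P i x \<in> loc_set_strict P i) \<and> coeff P *v x = rhs P}"


section \<open>The algorithm\<close>

definition weight :: "('v, 'n::finite, 'm::finite) network_problem \<Rightarrow> 'v \<Rightarrow> real" where
  "weight P j = 1 / real (Max ((\<lambda>l. card (closed_nbhd P l)) ` closed_nbhd P j))"

definition upper_model ::
  "('v, 'n::finite, 'm::finite) network_problem \<Rightarrow> ('v \<Rightarrow> real) \<Rightarrow> 'v \<Rightarrow> real ^ 'n \<Rightarrow> real ^ 'n \<Rightarrow> real" where
  "upper_model P L i z x =
     loc_obj P i z + grad_on (block_space P i) (loc_obj P i) z \<bullet> (x - z) + L i / 2 * (norm (x - z))\<^sup>2"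

text \<open>
  A decision of node \<open>i\<close> is a family \<open>p\<close> of which only the members indexed by \<open>closed_nbhd P i\<close> matter.
\<close>

definition subproblem_obj ::
  "('v, 'n::finite, 'm::finite) network_problem \<Rightarrow> ('v \<Rightarrow> real) \<Rightarrow> real \<Rightarrow> real ^ 'n \<Rightarrow> 'v \<Rightarrow>
     ('v \<Rightarrow> real ^ 'n) \<Rightarrow> real" where
  "subproblem_obj P L \<rho> x i p =
     (\<Sum>j\<in>closed_nbhd P i. upper_model P L j (block P j x) (block P j x + p j)
                            + \<rho> * loc_barrier P j (block P j x + p j))"

definition subproblem_feasible ::
  "('v, 'n::finite, 'm::finite) network_problem \<Rightarrow> real ^ 'n \<Rightarrow> 'v \<Rightarrow> ('v \<Rightarrow> real ^ 'n) set" where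
  "subproblem_feasible P x i =
     {p. (\<forall>j\<in>closed_nbhd P i. p j \<in> block_space P j \<and> block P j x + p j \<in> loc_set_strict P j) \<and>
         (\<Sum>j\<in>closed_nbhd P i. coeff P *v p j) = 0}"

definition dfm_run ::
  "('v, 'n::finite, 'm::finite) network_problem \<Rightarrow> ('v \<Rightarrow> real) \<Rightarrow> real \<Rightarrow> real ^ 'n \<Rightarrow>
     (nat \<Rightarrow> real ^ 'n) \<Rightarrow> bool" where
  "dfm_run P L \<rho> x0 x \<longleftrightarrow> x 0 = x0 \<and>
     (\<forall>k. \<exists>p.
        (\<forall>i. is_arg_min (subproblem_obj P L \<rho> (x k) i) (\<lambda>r. r \<in> subproblem_feasible P (x k) i) (p i)) \<and>
        (\<forall>i. block P i (x (Suc k)) =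
           block P i (x k) + (\<Sum>j\<in>closed_nbhd P i. weight P j *\<^sub>R p j i)))"


section \<open>The quantities in the complexity bounds\<close>

definition orth_proj_matrix :: "(real ^ 'n) set \<Rightarrow> real ^ 'n ^ 'n::finite" where
  "orth_proj_matrix S = (THE M. \<forall>x. M *v x \<in> S \<and> (\<forall>y\<in>S. (x - M *v x) \<bullet> y = 0))"

definition mixing_matrix :: "('v::finite, 'n::finite, 'm::finite) network_problem \<Rightarrow> real ^ 'n ^ 'n" where
  "mixing_matrix P = (\<Sum>i\<in>UNIV. weight P i *\<^sub>R orth_proj_matrix (reach_space P i))"

definition mat_eigenvalue :: "real ^ 'n ^ 'n \<Rightarrow> real \<Rightarrow> bool" where
  "mat_eigenvalue M \<mu> \<longleftrightarrow> (\<exists>v. v \<noteq> 0 \<and> M *v v = \<mu> *\<^sub>R v)"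

text \<open>
  The mixing matrix is symmetric and positive semidefinite.  It vanishes only if the matrix \<open>A\<close> is
  injective (under the reachability assumption); then the barrier problem has at most one feasible
  point and \<open>eps_range\<close> below is empty.
\<close>

definition lambda_W :: "('v::finite, 'n::finite, 'm::finite) network_problem \<Rightarrow> real" where
  "lambda_W P = Min {\<mu>. \<mu> \<noteq> 0 \<and> mat_eigenvalue (mixing_matrix P) \<mu>}"

definition barrier_param ::
  "('v::finite, 'n::finite, 'm::finite) network_problem \<Rightarrow> real ^ 'n \<Rightarrow> real \<Rightarrow> real \<Rightarrow> real" where
  "barrier_param P x0 flow \<epsilon> = \<epsilon>\<^sup>2 / (4 * (objective P x0 - flow) * barrier P x0)"

definition eps_optimal ::
  "('v::finite, 'n::finite, 'm::finite) network_problem \<Rightarrow> real \<Rightarrow> real ^ 'n \<Rightarrow> bool" where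
  "eps_optimal P \<epsilon> x \<longleftrightarrow> objective P x - opt_value P \<le> 2 * \<epsilon>"

text \<open>Meaningful only if some iterate is good enough, which has to be claimed separately.\<close>

definition k_eps ::
  "('v::finite, 'n::finite, 'm::finite) network_problem \<Rightarrow> (nat \<Rightarrow> real ^ 'n) \<Rightarrow> real \<Rightarrow> nat" where
  "k_eps P x \<epsilon> = (LEAST k. eps_optimal P \<epsilon> (x k))"

definition eps_range ::
  "('v::finite, 'n::finite, 'm::finite) network_problem \<Rightarrow> real ^ 'n \<Rightarrow> real set" where
  "eps_range P x0 = {0<..<2 * (objective P x0 - opt_value P)}"

end

theory Submission
  imports Defs
begin

text \<open>
  Why the bounds hold.  Since \<open>\<eta>\<^sub>j \<le> 1 / |N\<^sub>i|\<close> for every \<open>j\<close> in the closed neighbourhood \<open>N\<^sub>i\<close>, each block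
  of \<open>x\<^sup>k\<^sup>+\<^sup>1\<close> is a convex combination of the current block and of the points proposed by the neighbours.
  The local models are convex, majorise \<open>f\<^sub>i + \<rho> B\<^sub>i\<close> and agree with it at \<open>x\<^sup>k\<close>, so Jensen's inequality
  shows that \<open>F\<close> decreases by at least the weighted sum of the decreases of the subproblems
  (\<open>dfm_step\<close>).  As the subproblems are solved exactly, any competitor bounds these decreases from below.

  The competitors come from reachability.  For a strictly feasible \<open>z\<close>, the direction \<open>z - x\<^sup>k\<close> lies
  in the null space of \<open>A\<close> and splits into vectors \<open>u\<^sub>j \<in> S\<^sub>j\<close> of comparable norm; node \<open>j\<close> is compared
  with \<open>(s / \<eta>\<^sub>j) u\<^sub>j\<close>.  The first-order terms add up to \<open>s \<langle>\<nabla>F(x\<^sup>k), z - x\<^sup>k\<rangle>\<close>, which convexity bounds by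
  \<open>- s (F(x\<^sup>k) - F(z) + \<sigma>/2 |z - x\<^sup>k|\<^sup>2)\<close>.  For the second-order terms, \<open>F(x\<^sup>k) \<le> F(x\<^sup>0)\<close> keeps every
  constraint function below \<open>- \<delta>\<close> with \<open>\<delta>\<close> of order \<open>\<rho>\<close>, that is, of order \<open>\<epsilon>\<^sup>2\<close>.  Within a radius
  of order \<open>\<delta>\<close> the curvature of \<open>\<rho> B\<close> is of order \<open>\<rho> / \<delta>\<^sup>3\<close>, so that altogether (\<open>uniform_progress\<close>)
  \<open>F(x\<^sup>k\<^sup>+\<^sup>1) \<le> F(x\<^sup>k) - s (F(x\<^sup>k) - F(z) + \<sigma>/2 |z - x\<^sup>k|\<^sup>2) + (A / \<epsilon>\<^sup>4) s\<^sup>2 |z - x\<^sup>k|\<^sup>2\<close>.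

  The distances \<open>|z - x\<^sup>k|\<close> are bounded independently of \<open>\<epsilon>\<close>: by strong convexity in the second case,
  and in the first because compactness of one sublevel set of \<open>F\<close> excludes directions of recession
  (\<open>bounded_objective_sublevel\<close>).  With \<open>G\<^sub>k = F(x\<^sup>k) - F(z)\<close>, a step \<open>s\<close> of order \<open>\<epsilon>\<^sup>4\<close> gives
  \<open>G\<^sub>k\<^sub>+\<^sub>1 \<le> (1 - c \<epsilon>\<^sup>4) G\<^sub>k\<close> under strong convexity (\<open>linear_rate\<close>), and a step of order \<open>\<epsilon>\<^sup>4 G\<^sub>k\<close> gives
  \<open>G\<^sub>k\<^sub>+\<^sub>1 \<le> G\<^sub>k - c \<epsilon>\<^sup>4 G\<^sub>k\<^sup>2\<close> in general (\<open>sublinear_rate\<close>); hence \<open>G\<^sub>k\<close> is of order \<open>\<epsilon>\<close> after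
  \<open>O(\<epsilon>\<^sup>-\<^sup>4 ln (1/\<epsilon>))\<close> and \<open>O(\<epsilon>\<^sup>-\<^sup>5)\<close> steps.  This suffices because the value of \<open>\<rho>\<close> admits a strictly feasible
  \<open>z\<close> with \<open>F(z) \<le> f\<^sup>\<star> + 5/4 \<epsilon>\<close>: a small move from a near-optimal point towards \<open>x\<^sup>0\<close> (\<open>reference_point\<close>).

  The asymptotic bounds are for fixed problem data, so \<open>\<lambda>\<^sub>W\<close> is a constant, and a factor \<open>1 / \<lambda>\<^sub>W\<close> may be
  inserted as soon as \<open>\<lambda>\<^sub>W \<noteq> 0\<close>.  This holds because the symmetric, positive semidefinite matrix \<open>W\<close> is
  not zero when there is more than one feasible point (\<open>lambda_W_nonzero\<close>).
\<close>


section \<open>Gradients relative to a subspace\<close>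

lemma has_derivative_along_line:
  fixes h :: "'a::euclidean_space \<Rightarrow> real"
  assumes E: "subspace E" "x \<in> E" "u \<in> E"
    and D: "(h has_derivative (\<lambda>w. v \<bullet> w)) (at (x + t *\<^sub>R u) within E)"
  shows "((\<lambda>s. h (x + s *\<^sub>R u)) has_real_derivative v \<bullet> u) (at t)"
proof -
  have "((\<lambda>s. x + s *\<^sub>R u) has_derivative (\<lambda>s. s *\<^sub>R u)) (at t)"
    by (auto intro!: derivative_eq_intros)
  moreover have "range (\<lambda>s. x + s *\<^sub>R u) \<subseteq> E"
    using E by (auto intro!: subspace_add subspace_scale)
  hence "(h has_derivative (\<lambda>w. v \<bullet> w)) (at (x + t *\<^sub>R u) within range (\<lambda>s. x + s *\<^sub>R u))"
    by (rule has_derivative_subset[OF D])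
  ultimately have "((\<lambda>s. h (x + s *\<^sub>R u)) has_derivative (\<lambda>s. v \<bullet> (s *\<^sub>R u))) (at t)"
    by (rule has_derivative_in_compose)
  thus ?thesis
    by (simp add: has_field_derivative_def mult_commute_abs)
qed

text \<open>
  A derivative within a subspace is only determined on that subspace; projecting its Riesz vector onto
  the subspace changes none of the values that matter and makes the representative unique.
\<close>

lemma grad_on_works:
  assumes E: "subspace E" and d: "h differentiable_on E" and x: "x \<in> E"
  shows grad_on_mem: "grad_on E h x \<in> E"
    and grad_on_has_derivative: "(h has_derivative (\<lambda>u. grad_on E h x \<bullet> u)) (at x within E)"
proof -
  let ?G = "\<lambda>v. v \<in> E \<and> (h has_derivative (\<lambda>u. v \<bullet> u)) (at x within E)"
  obtain D where D: "(h has_derivative D) (at x within E)"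
    using d x by (auto simp: differentiable_on_def differentiable_def)
  have lin: "linear D" using D has_derivative_linear by blast
  define a where "a = adjoint D 1"
  have a: "D u = a \<bullet> u" for u
    using adjoint_works[OF lin, of u 1] by (simp add: a_def inner_commute)
  obtain v w where v: "v \<in> span E" and w: "\<And>z. z \<in> span E \<Longrightarrow> orthogonal w z" and avw: "a = v + w"
    using orthogonal_subspace_decomp_exists by metis
  have vE: "v \<in> E" using v E by (metis span_eq_iff)
  have Dv: "D u = v \<bullet> u" if "u \<in> E" for u
    using w[of u] that a[of u] avw by (simp add: span_base inner_left_distrib orthogonal_def)
  have "(h has_derivative (\<lambda>u. v \<bullet> u)) (at x within E)"
    unfolding has_derivative_within
  proof (intro conjI bounded_linear_inner_right)
    have "((\<lambda>y. (1 / norm (y - x)) *\<^sub>R (h y - (h x + D (y - x)))) \<longlongrightarrow> 0) (at x within E)"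
      using D by (simp add: has_derivative_within)
    moreover have "\<forall>\<^sub>F y in at x within E. (1 / norm (y - x)) *\<^sub>R (h y - (h x + D (y - x)))
        = (1 / norm (y - x)) *\<^sub>R (h y - (h x + v \<bullet> (y - x)))"
      unfolding eventually_at using E x Dv by (intro exI[of _ 1]) (auto simp: subspace_diff)
    ultimately show "((\<lambda>y. (1 / norm (y - x)) *\<^sub>R (h y - (h x + v \<bullet> (y - x)))) \<longlongrightarrow> 0) (at x within E)"
      by (rule Lim_transform_eventually)
  qed
  hence G: "?G v" using vE by simp
  have "v' = v''" if "?G v'" "?G v''" for v' v''
  proof -
    define u where "u = v' - v''"
    have uE: "u \<in> E" using that E by (auto simp: u_def subspace_diff)
    have "v' \<bullet> u = v'' \<bullet> u"
      using that has_derivative_along_line[OF E x uE, of h _ 0]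
      by (intro DERIV_unique[of "\<lambda>s. h (x + s *\<^sub>R u)" _ 0]) auto
    hence "u \<bullet> u = 0" by (simp add: u_def inner_diff_left)
    thus ?thesis by (simp add: u_def)
  qed
  with G have "\<exists>!v. ?G v" by auto
  hence "?G (grad_on E h x)"
    unfolding grad_on_def by (rule theI')
  thus "grad_on E h x \<in> E" "(h has_derivative (\<lambda>u. grad_on E h x \<bullet> u)) (at x within E)"
    by auto
qed

lemma DERIV_along_line:
  assumes "subspace E" "h differentiable_on E" "x \<in> E" "u \<in> E"
  shows "((\<lambda>s. h (x + s *\<^sub>R u)) has_real_derivative grad_on E h (x + t *\<^sub>R u) \<bullet> u) (at t)"
  by (rule has_derivative_along_line[OF assms(1,3,4)])
    (intro grad_on_has_derivative assms subspace_add subspace_scale)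

text \<open>
  Along the segment from \<open>x\<close> to \<open>y\<close>, the difference of the two sides has a nonpositive derivative, since
  the gradient moves by at most \<open>L t |y - x|\<close>.
\<close>

lemma smooth_fun_upper_bound:
  assumes E: "subspace E" and sm: "smooth_fun_on E L h" and x: "x \<in> E" and y: "y \<in> E"
  shows "h y \<le> h x + grad_on E h x \<bullet> (y - x) + L / 2 * (norm (y - x))\<^sup>2"
proof -
  define u where "u = y - x"
  have uE: "u \<in> E" using x y E by (simp add: u_def subspace_diff)
  have d: "h differentiable_on E" and lip: "L-lipschitz_on E (grad_on E h)"
    using sm by (auto simp: smooth_fun_on_def)
  let ?\<phi> = "\<lambda>t. h (x + t *\<^sub>R u) - t * (grad_on E h x \<bullet> u) - L / 2 * t\<^sup>2 * (norm u)\<^sup>2"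
  have "?\<phi> 1 \<le> ?\<phi> 0"
  proof (rule DERIV_nonpos_imp_nonincreasing[where f = ?\<phi>])
    fix t :: real assume t: "0 \<le> t" "t \<le> 1"
    let ?d = "grad_on E h (x + t *\<^sub>R u) \<bullet> u - grad_on E h x \<bullet> u - L * t * (norm u)\<^sup>2"
    have "(?\<phi> has_real_derivative ?d) (at t)"
      by (auto intro!: derivative_eq_intros DERIV_along_line[OF E d x uE])
    moreover have "?d \<le> 0"
    proof -
      have "grad_on E h (x + t *\<^sub>R u) \<bullet> u - grad_on E h x \<bullet> u
          \<le> norm (grad_on E h (x + t *\<^sub>R u) - grad_on E h x) * norm u"
        by (metis inner_diff_left norm_cauchy_schwarz)
      also have "\<dots> \<le> (L * norm (t *\<^sub>R u)) * norm u"
        using lipschitz_onD[OF lip, of "x + t *\<^sub>R u" x] x uE E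
        by (intro mult_right_mono) (auto simp: dist_norm subspace_add subspace_scale)
      also have "\<dots> = L * t * (norm u)\<^sup>2" using t by (simp add: power2_eq_square)
      finally show ?thesis by simp
    qed
    ultimately show "\<exists>d. (?\<phi> has_real_derivative d) (at t) \<and> d \<le> 0" by blast
  qed simp
  thus ?thesis by (simp add: u_def)
qed

lemma convex_on_above_tangent:
  assumes E: "subspace E" and d: "h differentiable_on E" and c: "convex_on E h"
    and x: "x \<in> E" and y: "y \<in> E"
  shows "h y \<ge> h x + grad_on E h x \<bullet> (y - x)"
proof -
  define u where "u = y - x"
  have uE: "u \<in> E" using x y E by (simp add: u_def subspace_diff)
  have mem: "x + t *\<^sub>R u \<in> E" for t using x uE E by (simp add: subspace_add subspace_scale)
  let ?\<phi> = "\<lambda>t. h (x + t *\<^sub>R u)"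
  have "convex_on UNIV ?\<phi>"
  proof (rule convex_onI)
    fix t a b :: real assume t: "0 < t" "t < 1"
    have "x + ((1 - t) *\<^sub>R a + t *\<^sub>R b) *\<^sub>R u = (1 - t) *\<^sub>R (x + a *\<^sub>R u) + t *\<^sub>R (x + b *\<^sub>R u)"
      by (simp add: algebra_simps)
    thus "?\<phi> ((1 - t) *\<^sub>R a + t *\<^sub>R b) \<le> (1 - t) * ?\<phi> a + t * ?\<phi> b"
      using convex_onD[OF c, of t "x + a *\<^sub>R u" "x + b *\<^sub>R u"] mem t by simp
  qed simp
  moreover have "(?\<phi> has_real_derivative grad_on E h x \<bullet> u) (at 0)"
    using DERIV_along_line[OF E d x uE, of 0] by simp
  ultimately have "?\<phi> 1 - ?\<phi> 0 \<ge> (grad_on E h x \<bullet> u) * (1 - 0)"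
    by (intro convex_on_imp_above_tangent[of UNIV]) auto
  thus ?thesis by (simp add: u_def)
qed

lemma strongly_convex_on_above_tangent:
  assumes E: "subspace E" and d: "h differentiable_on E" and c: "strongly_convex_on E \<sigma> h"
    and x: "x \<in> E" and y: "y \<in> E"
  shows "h y \<ge> h x + grad_on E h x \<bullet> (y - x) + \<sigma> / 2 * (norm (y - x))\<^sup>2"
proof -
  have "convex_on E h" using c by (simp add: strongly_convex_on_def)
  hence "grad_on E h x \<in> subdifferential_on E h x"
    using convex_on_above_tangent[OF E d _ x] grad_on_mem[OF E d x]
    by (fastforce simp: subdifferential_on_def)
  thus ?thesis using c x y by (force simp: strongly_convex_on_def norm_minus_commute)
qed

text \<open>
  At a point where all constraints are strict, a short step in the direction of the gradient stays in the
  set on which \<open>g j\<close> is Lipschitz, and by convexity \<open>g j\<close> increases along it at least at the rate \<open>|\<nabla>g|\<close>.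
\<close>

lemma norm_grad_on_le_lipschitz:
  assumes E: "subspace E" and J: "finite J" "j \<in> J"
    and d: "\<And>j. j \<in> J \<Longrightarrow> g j differentiable_on E"
    and c: "convex_on E (g j)"
    and lip: "K-lipschitz_on {y \<in> E. \<forall>j\<in>J. g j y \<le> 0} (g j)"
    and x: "x \<in> E" "\<And>j. j \<in> J \<Longrightarrow> g j x < 0"
  shows "norm (grad_on E (g j) x) \<le> K"
proof (cases "grad_on E (g j) x = 0")
  case True
  thus ?thesis using lip by (simp add: lipschitz_on_def)
next
  case False
  define v where "v = grad_on E (g j) x"
  have v: "v \<in> E" "v \<noteq> 0" using False grad_on_mem[OF E d x(1)] J by (auto simp: v_def)
  have "\<forall>\<^sub>F t in at_right 0. \<forall>l\<in>J. g l (x + t *\<^sub>R v) < 0"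
  proof (intro eventually_ball_finite J(1) ballI)
    fix l assume l: "l \<in> J"
    have "isCont (\<lambda>t. g l (x + t *\<^sub>R v)) 0"
      using DERIV_along_line[OF E d[OF l] x(1) v(1)] DERIV_isCont by blast
    hence "((\<lambda>t. g l (x + t *\<^sub>R v)) \<longlongrightarrow> g l x) (at 0)" by (simp add: isCont_def)
    hence "\<forall>\<^sub>F t in at 0. g l (x + t *\<^sub>R v) < 0"
      using x(2)[OF l] by (auto dest!: order_tendstoD(2))
    thus "\<forall>\<^sub>F t in at_right 0. g l (x + t *\<^sub>R v) < 0"
      by (simp add: eventually_at_split)
  qed
  hence "\<forall>\<^sub>F t in at_right 0. 0 < t \<and> (\<forall>l\<in>J. g l (x + t *\<^sub>R v) < 0)"
    by (intro eventually_conj eventually_at_right_less)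
  then obtain t :: real where t: "0 < t" "\<And>l. l \<in> J \<Longrightarrow> g l (x + t *\<^sub>R v) < 0"
    using eventually_happens'[OF trivial_limit_at_right_real] by blast
  have E': "x + t *\<^sub>R v \<in> E" using E x v by (simp add: subspace_add subspace_scale)
  have "t * (v \<bullet> v) \<le> g j (x + t *\<^sub>R v) - g j x"
    using convex_on_above_tangent[OF E d[OF J(2)] c x(1) E'] by (simp add: v_def)
  also have "\<dots> \<le> K * norm (t *\<^sub>R v)"
    using lipschitz_onD[OF lip, of "x + t *\<^sub>R v" x] E' x t
    by (force simp: dist_norm intro: less_imp_le)
  finally have "t * norm v * norm v \<le> t * norm v * K"
    using t by (simp add: mult.commute mult.left_commute power2_norm_eq_inner[symmetric] power2_eq_square)
  moreover have "t * norm v > 0" using t v by simp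
  ultimately show ?thesis by (simp add: v_def mult_le_cancel_left_pos)
qed

section \<open>Convexity\<close>

lemma convex_on_if_tangent:
  fixes f :: "'a::real_inner \<Rightarrow> real"
  assumes C: "convex C"
    and tangent: "\<And>x y. x \<in> C \<Longrightarrow> y \<in> C \<Longrightarrow> f y \<ge> f x + G x \<bullet> (y - x)"
  shows "convex_on C f"
proof (rule convex_onI[OF _ C])
  fix t :: real and x y assume t: "0 < t" "t < 1" and xy: "x \<in> C" "y \<in> C"
  define z where "z = (1 - t) *\<^sub>R x + t *\<^sub>R y"
  have z: "z \<in> C" unfolding z_def using C t xy by (auto simp: convex_alt)
  have "(1 - t) * (f z + G z \<bullet> (x - z)) + t * (f z + G z \<bullet> (y - z)) \<le> (1 - t) * f x + t * f y"
    using t xy z by (intro add_mono mult_left_mono tangent) auto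
  moreover have "(1 - t) * (G z \<bullet> (x - z)) + t * (G z \<bullet> (y - z)) = 0"
  proof -
    have "(1 - t) *\<^sub>R (x - z) + t *\<^sub>R (y - z) = 0" by (simp add: z_def algebra_simps)
    hence "G z \<bullet> ((1 - t) *\<^sub>R (x - z) + t *\<^sub>R (y - z)) = 0" by simp
    thus ?thesis by (simp add: inner_add_right)
  qed
  ultimately show "f ((1 - t) *\<^sub>R x + t *\<^sub>R y) \<le> (1 - t) * f x + t * f y"
    unfolding z_def[symmetric] by (simp add: algebra_simps)
qed

lemma convex_weighted_displacements:
  fixes x :: "'a::real_vector"
  assumes C: "convex C" and S: "finite S" and x: "x \<in> C"
    and p: "\<And>j. j \<in> S \<Longrightarrow> x + p j \<in> C"
    and a: "\<And>j. j \<in> S \<Longrightarrow> 0 \<le> a j" "sum a S \<le> 1"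
  shows "x + (\<Sum>j\<in>S. a j *\<^sub>R p j) \<in> C"
proof (cases "sum a S = 0")
  case True
  hence "a j = 0" if "j \<in> S" for j using that S a sum_nonneg_eq_0_iff by metis
  thus ?thesis using x by simp
next
  case False
  define s where "s = sum a S"
  have s: "0 < s" "s \<le> 1" using False a sum_nonneg[of S a] by (auto simp: s_def)
  have "(\<Sum>j\<in>S. (a j / s) *\<^sub>R (x + p j)) \<in> C"
    using S C s a p by (intro convex_sum) (auto simp: sum_divide_distrib[symmetric] s_def[symmetric])
  hence "(1 - s) *\<^sub>R x + s *\<^sub>R (\<Sum>j\<in>S. (a j / s) *\<^sub>R (x + p j)) \<in> C"
    using C x s by (auto simp: convex_alt)
  moreover have "s *\<^sub>R (\<Sum>j\<in>S. (a j / s) *\<^sub>R (x + p j)) = s *\<^sub>R x + (\<Sum>j\<in>S. a j *\<^sub>R p j)"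
    using s by (simp add: scaleR_sum_right scaleR_add_right sum.distrib scaleR_sum_left[symmetric]
        sum_divide_distrib[symmetric] s_def)
  ultimately show ?thesis by (simp add: scaleR_diff_left)
qed

text \<open>
  Jensen's inequality for weights with sum at most one, the remaining weight being given to \<open>x\<close>.  It is the
  set version applied to the epigraph.
\<close>

lemma convex_on_weighted_displacements:
  fixes f :: "'a::real_vector \<Rightarrow> real"
  assumes f: "convex_on C f" and S: "finite S" and x: "x \<in> C"
    and p: "\<And>j. j \<in> S \<Longrightarrow> x + p j \<in> C"
    and a: "\<And>j. j \<in> S \<Longrightarrow> 0 \<le> a j" "sum a S \<le> 1"
  shows "f (x + (\<Sum>j\<in>S. a j *\<^sub>R p j)) \<le> f x + (\<Sum>j\<in>S. a j * (f (x + p j) - f x))"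
proof -
  have "(x, f x) + (\<Sum>j\<in>S. a j *\<^sub>R (p j, f (x + p j) - f x)) \<in> epigraph C f"
    using f x p by (intro convex_weighted_displacements S a convex_epigraphI) (auto simp: epigraph_def)
  moreover have "(\<Sum>j\<in>S. a j *\<^sub>R (p j, f (x + p j) - f x))
      = (\<Sum>j\<in>S. a j *\<^sub>R p j, \<Sum>j\<in>S. a j * (f (x + p j) - f x))"
    by (simp add: sum_prod)
  ultimately show ?thesis by (simp add: epigraph_def)
qed

lemma convex_on_strict_sublevel:
  assumes "convex_on S f"
  shows "convex {x \<in> S. f x < (c::real)}"
proof (rule convexI)
  fix x y and u v :: real assume "x \<in> {x \<in> S. f x < c}" "y \<in> {x \<in> S. f x < c}" and uv: "0 \<le> u" "0 \<le> v" "u + v = 1"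
  hence xy: "x \<in> S" "y \<in> S" "f x < c" "f y < c" by auto
  have "f (u *\<^sub>R x + v *\<^sub>R y) \<le> u * f x + v * f y"
    using assms xy uv by (auto simp: convex_on_def)
  also have "\<dots> < c" using xy uv by (intro convex_bound_lt) auto
  finally show "u *\<^sub>R x + v *\<^sub>R y \<in> {x \<in> S. f x < c}"
    using convexD[OF convex_on_imp_convex[OF assms]] xy uv by auto
qed

text \<open>
  A convex function that increases anywhere on a ray increases at least linearly from there on.
\<close>

lemma convex_bounded_above_on_ray:
  fixes h :: "'a::real_vector \<Rightarrow> real"
  assumes h: "convex_on C h" and ray: "\<And>t. 0 \<le> t \<Longrightarrow> x + t *\<^sub>R d \<in> C"
    and bound: "\<And>t. 0 \<le> t \<Longrightarrow> h (x + t *\<^sub>R d) \<le> M" and t: "0 \<le> t"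
  shows "h (x + t *\<^sub>R d) \<le> h x"
proof (rule ccontr)
  assume "\<not> h (x + t *\<^sub>R d) \<le> h x"
  hence e: "0 < h (x + t *\<^sub>R d) - h x" (is "0 < ?e") by simp
  have "h x \<le> M" using bound[of 0] by simp
  \<comment> \<open>extending the step from \<open>0\<close> to \<open>t\<close> by the factor \<open>n\<close> lifts \<open>h\<close> by more than \<open>M - h x\<close>\<close>
  define n where "n = (M - h x) / ?e + 1"
  have n: "1 \<le> n" using e \<open>h x \<le> M\<close> by (simp add: n_def)
  have "x + t *\<^sub>R d = (1 - 1 / n) *\<^sub>R x + (1 / n) *\<^sub>R (x + (n * t) *\<^sub>R d)"
    using n by (simp add: algebra_simps)
  hence "h (x + t *\<^sub>R d) \<le> (1 - 1 / n) * h x + (1 / n) * h (x + (n * t) *\<^sub>R d)"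
    using convex_onD[OF h, of "1 / n" x "x + (n * t) *\<^sub>R d"] ray[of 0] ray[of "n * t"] n t by simp
  also have "\<dots> \<le> (1 - 1 / n) * h x + (1 / n) * M"
    using bound[of "n * t"] n t by (intro add_left_mono mult_left_mono) auto
  finally have "n * ?e \<le> M - h x" using n by (simp add: field_simps)
  moreover have "n * ?e = M - h x + ?e" using e by (simp add: n_def field_simps)
  ultimately show False using e by simp
qed

text \<open>
  The direction \<open>d\<close> is a limit of normalised directions towards points of \<open>D\<close> that escape to infinity; the
  segments from \<open>x\<close> to these points lie in \<open>D\<close>.
\<close>

lemma closed_convex_unbounded_ray:
  fixes D :: "'a::euclidean_space set"
  assumes D: "closed D" "convex D" "x \<in> D" "\<not> bounded D"
  obtains d where "norm d = 1" "\<And>t. 0 \<le> t \<Longrightarrow> x + t *\<^sub>R d \<in> D"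
proof -
  have "\<exists>y\<in>D. real n < norm (y - x)" for n
  proof (rule ccontr)
    assume "\<not> ?thesis"
    hence "D \<subseteq> cball x (real n)" by (auto simp: dist_norm norm_minus_commute not_less)
    thus False using D(4) bounded_subset bounded_cball by blast
  qed
  then obtain y where y: "\<And>n. y n \<in> D" "\<And>n. real n < norm (y n - x)" by metis
  define e where "e n = (1 / norm (y n - x)) *\<^sub>R (y n - x)" for n
  have pos: "0 < norm (y n - x)" for n using y(2)[of n] by linarith
  have "e n \<in> sphere 0 1" for n using pos[of n] by (simp add: e_def)
  then obtain d r where d: "d \<in> sphere 0 1" and r: "strict_mono r" "(e \<circ> r) \<longlonglongrightarrow> d"
    using compact_sphere[of 0 1] unfolding compact_def by blast
  show thesis
  proof (rule that[of d])
    show "norm d = 1" using d by simp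
    fix t :: real assume t: "0 \<le> t"
    have "(\<lambda>n. x + t *\<^sub>R (e \<circ> r) n) \<longlonglongrightarrow> x + t *\<^sub>R d" by (intro tendsto_intros r)
    moreover have "\<forall>\<^sub>F n in sequentially. x + t *\<^sub>R (e \<circ> r) n \<in> D"
    proof (rule eventually_sequentiallyI[of "nat \<lceil>t\<rceil>"])
      fix n assume "nat \<lceil>t\<rceil> \<le> n"
      hence "t \<le> real (r n)" using seq_suble[OF r(1), of n] by linarith
      hence s: "t / norm (y (r n) - x) \<le> 1" using y(2)[of "r n"] pos[of "r n"] by simp
      have "x + t *\<^sub>R (e \<circ> r) n = (1 - t / norm (y (r n) - x)) *\<^sub>R x + (t / norm (y (r n) - x)) *\<^sub>R y (r n)"
        by (simp add: e_def algebra_simps)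
      also have "\<dots> \<in> D" using D(2,3) y(1) s t pos[of "r n"] by (simp add: convex_alt)
      finally show "x + t *\<^sub>R (e \<circ> r) n \<in> D" .
    qed
    ultimately show "x + t *\<^sub>R d \<in> D"
      by (intro Lim_in_closed_set[OF D(1) _ sequentially_bot])
  qed
qed

section \<open>The inverse barrier of one constraint\<close>

text \<open>
  The function \<open>-1/g\<close> is convex where \<open>g < 0\<close>.  The tangent inequality follows from that of \<open>g\<close> and from
  \<open>1/b - 1/a - (a - b)/a\<^sup>2 = (a - b)\<^sup>2 / (a\<^sup>2 b) \<ge> 0\<close> for \<open>a = -g x\<close> and \<open>b = -g z\<close>.
\<close>

lemma inverse_barrier_above_tangent:
  assumes E: "subspace E" and d: "g differentiable_on E" and c: "convex_on E g"
    and x: "x \<in> E" "g x < 0" and z: "z \<in> E" "g z < 0"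
  shows "- (1 / g z) \<ge> - (1 / g x) + ((1 / (g x)\<^sup>2) *\<^sub>R grad_on E g x) \<bullet> (z - x)"
proof -
  have "- (1 / g z) - (- (1 / g x)) - (g z - g x) / (g x)\<^sup>2 = - ((g z - g x)\<^sup>2 / ((g x)\<^sup>2 * g z))"
    using x z by (simp add: field_simps power2_eq_square)
  also have "\<dots> \<ge> 0" using x z by (simp add: divide_le_0_iff mult_le_0_iff)
  finally have "- (1 / g z) \<ge> - (1 / g x) + (g z - g x) / (g x)\<^sup>2" by simp
  moreover have "(grad_on E g x \<bullet> (z - x)) / (g x)\<^sup>2 \<le> (g z - g x) / (g x)\<^sup>2"
    using convex_on_above_tangent[OF E d c x(1) z(1)] by (intro divide_right_mono) auto
  ultimately show ?thesis by simp
qed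

text \<open>
  The barrier is not smooth near the boundary, but at depth \<open>\<delta>\<close> it has a quadratic upper bound within a radius
  of order \<open>\<delta>\<close>, where \<open>-g\<close> stays above \<open>\<delta>/2\<close>.  The curvature \<open>\<beta> / \<delta>\<^sup>2 + |\<nabla>g|\<^sup>2 / \<delta>\<^sup>3\<close> (up to constants) is what
  eventually costs \<open>\<epsilon>\<^sup>-\<^sup>4\<close> iterations.
\<close>

lemma inverse_barrier_upper_bound:
  assumes E: "subspace E" and sm: "smooth_fun_on E \<beta> g" and \<beta>: "0 \<le> \<beta>"
    and c: "convex_on E g"
    and G: "norm (grad_on E g x) \<le> K" and x: "x \<in> E" and u: "u \<in> E"
    and \<delta>: "0 < \<delta>" "g x \<le> - \<delta>" and small: "norm u \<le> 1" "(K + \<beta>) * norm u \<le> \<delta> / 2"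
  shows "g (x + u) \<le> - \<delta> / 2"
    and "- (1 / g (x + u)) \<le> - (1 / g x) + ((1 / (g x)\<^sup>2) *\<^sub>R grad_on E g x) \<bullet> u
           + (\<beta> / (2 * \<delta>\<^sup>2) + 2 * (K + \<beta>)\<^sup>2 / \<delta> ^ 3) * (norm u)\<^sup>2"
proof -
  let ?v = "grad_on E g x"
  have xu: "x + u \<in> E" using E x u by (simp add: subspace_add)
  have d: "g differentiable_on E" using sm by (simp add: smooth_fun_on_def)
  have up: "g (x + u) - g x \<le> ?v \<bullet> u + \<beta> / 2 * (norm u)\<^sup>2"
    using smooth_fun_upper_bound[OF E sm x xu] by simp
  have vu: "\<bar>?v \<bullet> u\<bar> \<le> K * norm u"
    using Cauchy_Schwarz_ineq2[of ?v u] mult_right_mono[OF G norm_ge_zero[of u]] by linarith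
  have "(norm u)\<^sup>2 \<le> norm u" using small(1) by (simp add: power2_eq_square mult_left_le)
  hence sq: "\<beta> / 2 * (norm u)\<^sup>2 \<le> \<beta> * norm u"
    using \<beta> mult_left_mono[of "(norm u)\<^sup>2" "norm u" \<beta>] mult_nonneg_nonneg[OF \<beta> norm_ge_zero[of u]] by linarith
  have D1: "g (x + u) - g x \<le> (K + \<beta>) * norm u" using up vu sq by (simp add: algebra_simps)
  thus g': "g (x + u) \<le> - \<delta> / 2" using small(2) \<delta> by simp
  have "g (x + u) - g x \<ge> ?v \<bullet> u"
    using convex_on_above_tangent[OF E d c x xu] by simp
  hence "g x - g (x + u) \<le> (K + \<beta>) * norm u"
    using vu mult_nonneg_nonneg[OF \<beta> norm_ge_zero[of u]] by (simp add: algebra_simps)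
  with D1 have "\<bar>g (x + u) - g x\<bar> \<le> (K + \<beta>) * norm u" by simp
  hence D: "(g (x + u) - g x)\<^sup>2 \<le> (K + \<beta>)\<^sup>2 * (norm u)\<^sup>2"
    by (metis abs_ge_zero power2_abs power_mono power_mult_distrib)
  define a b e where "a = - g x" and "b = - g (x + u)" and "e = g (x + u) - g x"
  have ab: "\<delta> \<le> a" "\<delta> / 2 \<le> b" "e = a - b" using \<delta> g' by (auto simp: a_def b_def e_def)
  have pos: "0 < a" "0 < b" using ab \<delta> by auto
  have "1 / b = 1 / a + e / a\<^sup>2 + e\<^sup>2 / (a\<^sup>2 * b)"
    unfolding ab(3) using pos by (simp add: field_simps power2_eq_square)
  moreover have "e / a\<^sup>2 \<le> (?v \<bullet> u) / a\<^sup>2 + \<beta> / (2 * \<delta>\<^sup>2) * (norm u)\<^sup>2"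
  proof -
    have "e / a\<^sup>2 \<le> (?v \<bullet> u + \<beta> / 2 * (norm u)\<^sup>2) / a\<^sup>2"
      using up by (intro divide_right_mono) (auto simp: e_def)
    also have "\<dots> = (?v \<bullet> u) / a\<^sup>2 + (\<beta> / 2 * (norm u)\<^sup>2) / a\<^sup>2" by (simp add: add_divide_distrib)
    also have "(\<beta> / 2 * (norm u)\<^sup>2) / a\<^sup>2 \<le> (\<beta> / 2 * (norm u)\<^sup>2) / \<delta>\<^sup>2"
      using ab \<delta> \<beta> pos by (intro divide_left_mono power_mono) auto
    finally show ?thesis by simp
  qed
  moreover have "e\<^sup>2 / (a\<^sup>2 * b) \<le> 2 * (K + \<beta>)\<^sup>2 / \<delta> ^ 3 * (norm u)\<^sup>2"
  proof -
    have "e\<^sup>2 / (a\<^sup>2 * b) \<le> ((K + \<beta>)\<^sup>2 * (norm u)\<^sup>2) / (\<delta>\<^sup>2 * (\<delta> / 2))"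
      using ab \<delta> D pos by (intro frac_le mult_mono power_mono) (auto simp: e_def)
    also have "\<dots> = 2 * (K + \<beta>)\<^sup>2 / \<delta> ^ 3 * (norm u)\<^sup>2"
      by (simp add: power3_eq_cube power2_eq_square)
    finally show ?thesis .
  qed
  ultimately have "1 / b \<le> 1 / a + (?v \<bullet> u) / a\<^sup>2 + (\<beta> / (2 * \<delta>\<^sup>2) + 2 * (K + \<beta>)\<^sup>2 / \<delta> ^ 3) * (norm u)\<^sup>2"
    unfolding distrib_right by linarith
  thus "- (1 / g (x + u)) \<le> - (1 / g x) + ((1 / (g x)\<^sup>2) *\<^sub>R ?v) \<bullet> u
           + (\<beta> / (2 * \<delta>\<^sup>2) + 2 * (K + \<beta>)\<^sup>2 / \<delta> ^ 3) * (norm u)\<^sup>2"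
    by (simp add: a_def b_def)
qed

section \<open>Sums of subspaces, symmetric operators and a scalar recursion\<close>

text \<open>
  Fixing one decomposition for each vector of an orthonormal basis of the sum makes the components depend
  linearly, hence boundedly, on \<open>w\<close>.
\<close>

lemma bounded_subspace_decomposition:
  fixes S :: "'i::finite \<Rightarrow> 'a::euclidean_space set"
  assumes S: "\<And>i. subspace (S i)"
  obtains K where "0 \<le> K"
    and "\<And>w. w \<in> {(\<Sum>i\<in>UNIV. u i) | u. \<forall>i. u i \<in> S i} \<Longrightarrow>
          \<exists>u. (\<forall>i. u i \<in> S i) \<and> w = (\<Sum>i\<in>UNIV. u i) \<and> (\<forall>i. norm (u i) \<le> K * norm w)"
proof -
  let ?T = "{(\<Sum>i\<in>UNIV. u i) | u. \<forall>i. u i \<in> S i}"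
  have "subspace ?T"
    unfolding subspace_def
  proof (intro conjI ballI allI)
    show "0 \<in> ?T" using S by (auto intro!: exI[of _ "\<lambda>_. 0"] simp: subspace_0)
  next
    fix x y assume "x \<in> ?T" "y \<in> ?T"
    then obtain u v where "\<forall>i. u i \<in> S i" "\<forall>i. v i \<in> S i" "x = (\<Sum>i\<in>UNIV. u i)" "y = (\<Sum>i\<in>UNIV. v i)" by blast
    thus "x + y \<in> ?T" using S by (auto intro!: exI[of _ "\<lambda>i. u i + v i"] simp: subspace_add sum.distrib)
  next
    fix c x assume "x \<in> ?T"
    then obtain u where "\<forall>i. u i \<in> S i" "x = (\<Sum>i\<in>UNIV. u i)" by blast
    thus "c *\<^sub>R x \<in> ?T" using S by (auto intro!: exI[of _ "\<lambda>i. c *\<^sub>R u i"] simp: subspace_scale scaleR_sum_right)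
  qed
  then obtain T where T: "T = ?T" "subspace T" by blast
  obtain B where B: "B \<subseteq> T" "pairwise orthogonal B" "\<And>x. x \<in> B \<Longrightarrow> norm x = 1"
    "independent B" "span B = T"
    using orthonormal_basis_subspace[OF T(2)] by metis
  have fin: "finite B" using B(4) by (rule independent_imp_finite)
  have "\<forall>b\<in>B. \<exists>u. (\<forall>i. u i \<in> S i) \<and> b = (\<Sum>i\<in>UNIV. u i)" using B(1) unfolding T by blast
  then obtain U where U: "\<And>b i. b \<in> B \<Longrightarrow> U b i \<in> S i" "\<And>b. b \<in> B \<Longrightarrow> b = (\<Sum>i\<in>UNIV. U b i)"
    by metis
  define K where "K = (\<Sum>i\<in>UNIV. \<Sum>b\<in>B. norm (U b i))"
  show thesis
  proof (rule that[of K])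
    show "0 \<le> K" unfolding K_def by (intro sum_nonneg norm_ge_zero)
  next
    fix w assume w: "w \<in> ?T"
    let ?u = "\<lambda>i. \<Sum>b\<in>B. (w \<bullet> b) *\<^sub>R U b i"
    have "w = (\<Sum>b\<in>B. (w \<bullet> b) *\<^sub>R b)"
      using orthonormal_basis_expand[OF B(2,3) _ fin, of w] w B(5) T by simp
    also have "\<dots> = (\<Sum>b\<in>B. (w \<bullet> b) *\<^sub>R (\<Sum>i\<in>UNIV. U b i))"
      using U(2) by (intro sum.cong) auto
    also have "\<dots> = (\<Sum>i\<in>UNIV. ?u i)"
      unfolding scaleR_sum_right by (rule sum.swap)
    finally have "w = (\<Sum>i\<in>UNIV. ?u i)" .
    moreover have "?u i \<in> S i" for i
      using S U(1) by (intro subspace_sum subspace_scale) auto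
    moreover have "norm (?u i) \<le> K * norm w" for i
    proof -
      have "norm (?u i) \<le> (\<Sum>b\<in>B. norm w * norm (U b i))"
      proof (rule sum_norm_le)
        fix b assume "b \<in> B"
        thus "norm ((w \<bullet> b) *\<^sub>R U b i) \<le> norm w * norm (U b i)"
          using Cauchy_Schwarz_ineq2[of w b] B(3) by (simp add: mult_right_mono)
      qed
      also have "\<dots> = norm w * (\<Sum>b\<in>B. norm (U b i))" by (simp add: sum_distrib_left)
      also have "\<dots> \<le> norm w * K"
        unfolding K_def
        by (intro mult_left_mono member_le_sum[of i UNIV "\<lambda>i. \<Sum>b\<in>B. norm (U b i)"]) (auto intro: sum_nonneg)
      finally show ?thesis by (simp add: mult.commute)
    qed
    ultimately show "\<exists>u. (\<forall>i. u i \<in> S i) \<and> w = (\<Sum>i\<in>UNIV. u i) \<and> (\<forall>i. norm (u i) \<le> K * norm w)"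
      by (intro exI[of _ ?u]) simp
  qed
qed

text \<open>
  Eigenvectors of distinct eigenvalues are orthogonal, hence linearly independent.
\<close>

lemma finite_symmetric_eigenvalues:
  fixes f :: "'a::euclidean_space \<Rightarrow> 'a"
  assumes sym: "\<And>x y. f x \<bullet> y = x \<bullet> f y"
  shows "finite {\<mu>. \<exists>v. v \<noteq> 0 \<and> f v = \<mu> *\<^sub>R v}" (is "finite ?E")
proof -
  have "\<forall>\<mu>\<in>?E. \<exists>v. v \<noteq> 0 \<and> f v = \<mu> *\<^sub>R v" by blast
  then obtain v where v: "\<And>\<mu>. \<mu> \<in> ?E \<Longrightarrow> v \<mu> \<noteq> 0 \<and> f (v \<mu>) = \<mu> *\<^sub>R v \<mu>" by metis
  have inj: "inj_on v ?E"
  proof (rule inj_onI)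
    fix \<mu> \<nu> assume m: "\<mu> \<in> ?E" "\<nu> \<in> ?E" "v \<mu> = v \<nu>"
    hence "\<mu> *\<^sub>R v \<mu> = \<nu> *\<^sub>R v \<mu>" using v[OF m(1)] v[OF m(2)] by metis
    thus "\<mu> = \<nu>" using v[OF m(1)] by simp
  qed
  have "pairwise orthogonal (v ` ?E)"
  proof (rule pairwiseI)
    fix a b assume "a \<in> v ` ?E" "b \<in> v ` ?E" "a \<noteq> b"
    then obtain \<mu> \<nu> where m: "\<mu> \<in> ?E" "\<nu> \<in> ?E" "a = v \<mu>" "b = v \<nu>" "\<mu> \<noteq> \<nu>" by blast
    have "\<mu> * (a \<bullet> b) = \<nu> * (a \<bullet> b)" using sym[of a b] v[OF m(1)] v[OF m(2)] by (simp add: m)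
    thus "orthogonal a b" using m(5) by (simp add: orthogonal_def)
  qed
  moreover have "0 \<notin> v ` ?E" using v by force
  ultimately have "finite (v ` ?E)"
    by (intro independent_imp_finite pairwise_orthogonal_independent)
  thus ?thesis using inj by (rule finite_imageD)
qed

text \<open>
  The quadratic form attains its maximum on the unit sphere at an eigenvector, and the maximum is the
  eigenvalue.
\<close>

lemma symmetric_positive_eigenvalue:
  fixes f :: "'a::euclidean_space \<Rightarrow> 'a"
  assumes lin: "linear f" and sym: "\<And>x y. f x \<bullet> y = x \<bullet> f y" and u: "0 < f u \<bullet> u"
  obtains \<mu> v where "0 < \<mu>" "v \<noteq> 0" "f v = \<mu> *\<^sub>R v"
proof -
  have u0: "u \<noteq> 0" using u by auto
  have cont: "continuous_on (sphere 0 1) (\<lambda>x. f x \<bullet> x)"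
    using lin by (intro continuous_on_inner continuous_on_id linear_continuous_on) (simp add: linear_conv_bounded_linear)
  have "(1 / norm u) *\<^sub>R u \<in> sphere 0 1" using u0 by simp
  hence "sphere 0 1 \<noteq> ({} :: 'a set)" by blast
  then obtain v where v: "v \<in> sphere 0 1" "\<And>y. y \<in> sphere 0 1 \<Longrightarrow> f y \<bullet> y \<le> f v \<bullet> v"
    using continuous_attains_sup[OF compact_sphere _ cont] by blast
  define \<mu> where "\<mu> = f v \<bullet> v"
  have nv: "v \<bullet> v = 1" using v(1) by (simp add: power2_norm_eq_inner[symmetric])
  have le: "f y \<bullet> y \<le> \<mu> * (y \<bullet> y)" for y
  proof (cases "y = 0")
    case True
    thus ?thesis by simp
  next
    case False
    let ?y = "(1 / norm y) *\<^sub>R y"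
    have "f ?y \<bullet> ?y \<le> \<mu>" unfolding \<mu>_def using False by (intro v(2)) simp
    hence "(f y \<bullet> y) / (norm y)\<^sup>2 \<le> \<mu>"
      by (simp add: linear_cmul[OF lin] power2_eq_square)
    thus ?thesis using False by (simp add: field_simps power2_norm_eq_inner[symmetric])
  qed
  have "0 < \<mu>" using le[of u] u u0 by (smt (verit) inner_gt_zero_iff mult_nonneg_nonneg mult_le_0_iff)
  moreover have "v \<noteq> 0" using nv by auto
  moreover have "f v = \<mu> *\<^sub>R v"
  proof -
    define y where "y = f v - \<mu> *\<^sub>R v"
    define K where "K = \<bar>\<mu> * (y \<bullet> y) - f y \<bullet> y\<bar> + 1"
    have vy: "f v \<bullet> y - \<mu> * (v \<bullet> y) = y \<bullet> y" by (simp add: y_def inner_diff_left)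
    have "2 * t * (y \<bullet> y) \<le> t\<^sup>2 * K" for t :: real
    proof -
      have "f (v + t *\<^sub>R y) \<bullet> (v + t *\<^sub>R y) = \<mu> + 2 * t * (f v \<bullet> y) + t\<^sup>2 * (f y \<bullet> y)"
        using sym[of y v] by (simp add: linear_add[OF lin] linear_cmul[OF lin] inner_add_left inner_add_right
            \<mu>_def power2_eq_square inner_commute algebra_simps)
      moreover have "\<mu> * ((v + t *\<^sub>R y) \<bullet> (v + t *\<^sub>R y)) = \<mu> + 2 * t * (\<mu> * (v \<bullet> y)) + t\<^sup>2 * (\<mu> * (y \<bullet> y))"
        using nv by (simp add: inner_add_left inner_add_right power2_eq_square inner_commute algebra_simps)
      ultimately have "2 * t * (f v \<bullet> y) - 2 * t * (\<mu> * (v \<bullet> y)) \<le> t\<^sup>2 * (\<mu> * (y \<bullet> y)) - t\<^sup>2 * (f y \<bullet> y)"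
        using le[of "v + t *\<^sub>R y"] by linarith
      hence "2 * t * (y \<bullet> y) \<le> t\<^sup>2 * (\<mu> * (y \<bullet> y) - f y \<bullet> y)"
        unfolding vy[symmetric] by (simp add: algebra_simps)
      also have "\<dots> \<le> t\<^sup>2 * K" by (intro mult_left_mono) (auto simp: K_def)
      finally show ?thesis .
    qed
    \<comment> \<open>this \<open>t\<close> maximises the excess of the left side over the right side\<close>
    from this[of "(y \<bullet> y) / K"] have "2 * ((y \<bullet> y) * (y \<bullet> y) / K) \<le> (y \<bullet> y) * (y \<bullet> y) / K"
      by (simp add: power2_eq_square K_def)
    hence "(y \<bullet> y) * (y \<bullet> y) / K \<le> 0" by linarith
    moreover have "0 < K" by (simp add: K_def)
    ultimately have "(y \<bullet> y)\<^sup>2 \<le> 0" by (simp add: divide_le_0_iff power2_eq_square)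
    hence "y \<bullet> y = 0" by simp
    thus ?thesis by (simp add: y_def)
  qed
  ultimately show thesis by (rule that)
qed

text \<open>
  The reciprocals \<open>1 / G k\<close> grow by at least \<open>a\<close> in each step.
\<close>

lemma sublinear_recursion:
  fixes G :: "nat \<Rightarrow> real"
  assumes a: "0 \<le> a" and pos: "\<And>k. k \<le> n \<Longrightarrow> 0 < G k"
    and rec: "\<And>k. k < n \<Longrightarrow> G (Suc k) \<le> G k - a * (G k)\<^sup>2"
  shows "a * real n \<le> 1 / G n"
  using pos rec
proof (induction n)
  case 0
  thus ?case by (simp add: less_imp_le)
next
  case (Suc n)
  have g: "0 < G n" "0 < G (Suc n)" using Suc.prems(1) by simp_all
  have r: "G (Suc n) \<le> G n - a * (G n)\<^sup>2" using Suc.prems(2) by simp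
  have "a * (G n)\<^sup>2 \<ge> 0" using a by simp
  hence "G (Suc n) \<le> G n" using r by linarith
  hence "a * (G n * G (Suc n)) \<le> a * (G n)\<^sup>2"
    using a g by (intro mult_left_mono) (auto simp: power2_eq_square)
  hence "a * (G n * G (Suc n)) \<le> G n - G (Suc n)" using r by linarith
  hence "a + 1 / G n \<le> 1 / G (Suc n)" using g by (simp add: field_simps)
  moreover have "a * real n \<le> 1 / G n" using Suc by simp
  ultimately show ?case by (simp add: distrib_left)
qed

section \<open>Blocks, neighbourhoods and weights\<close>

lemma linear_block: "linear (block P i)"
  by (rule linearI) (auto simp: block_def vec_eq_iff)

lemmas block_simps = linear_add[OF linear_block] linear_diff[OF linear_block]
  linear_cmul[OF linear_block] linear_sum[OF linear_block] linear_0[OF linear_block]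

lemma subspace_block_space: "subspace (block_space P i)"
  by (auto simp: subspace_def block_space_def)

lemma block_mem [simp]: "block P i x \<in> block_space P i"
  by (auto simp: block_def block_space_def)

lemma sum_blocks: "(\<Sum>i\<in>UNIV. block (P :: ('v::finite, 'n::finite, 'm::finite) network_problem) i x) = x"
  by (simp add: vec_eq_iff block_def)

lemma coeff_sum_blocks:
  "(\<Sum>i\<in>UNIV. coeff P *v block P i x) = coeff (P :: ('v::finite, 'n::finite, 'm::finite) network_problem) *v x"
proof -
  have "(\<Sum>i\<in>UNIV. coeff P *v block P i x) = coeff P *v (\<Sum>i\<in>UNIV. block P i x)"
    by (simp add: linear_sum)
  thus ?thesis by (simp add: sum_blocks)
qed

lemma norm_block_le: "norm (block P i x) \<le> norm x"
  by (rule norm_le_componentwise_cart) (auto simp: block_def)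

lemma inner_block: "v \<in> block_space P i \<Longrightarrow> v \<bullet> block P i u = v \<bullet> u"
  by (auto simp: block_def block_space_def inner_vec_def intro!: sum.cong)

lemma block_inner_block_self: "block P i x \<bullet> block P i x = block P i x \<bullet> x"
  by (auto simp: block_def inner_vec_def intro!: sum.cong)

lemma sum_norm_block_squared:
  "(\<Sum>i\<in>UNIV. (norm (block (P :: ('v::finite, 'n::finite, 'm::finite) network_problem) i x))\<^sup>2) = (norm x)\<^sup>2"
proof -
  have "(\<Sum>i\<in>UNIV. block P i x \<bullet> block P i x) = (\<Sum>i\<in>UNIV. block P i x) \<bullet> x"
    by (simp add: block_inner_block_self inner_sum_left)
  thus ?thesis by (simp add: sum_blocks power2_norm_eq_inner)
qed

lemma continuous_on_block:
  assumes "continuous_on (block_space P i) h"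
  shows "continuous_on UNIV (\<lambda>x. h (block P i x))"
proof (rule continuous_on_compose2[OF assms])
  show "continuous_on UNIV (block P i)"
    using linear_block[of P i] by (simp add: linear_continuous_on linear_conv_bounded_linear)
qed auto

lemma convex_coeff_constraint: "convex {x. coeff P *v x = rhs P}"
proof -
  have "{x. coeff P *v x = rhs P} = (\<lambda>x. coeff P *v x) -` {rhs P}" by auto
  thus ?thesis by (simp add: convex_linear_vimage)
qed

lemma mem_closed_nbhd_commute: "j \<in> closed_nbhd P i \<longleftrightarrow> i \<in> closed_nbhd P j"
  by (auto simp: closed_nbhd_def nbhd_def insert_commute)

lemma sum_closed_nbhd_swap:
  fixes P :: "('v::finite, 'n::finite, 'm::finite) network_problem"
  shows "(\<Sum>i\<in>UNIV. \<Sum>j\<in>closed_nbhd P i. a j i) = (\<Sum>j\<in>UNIV. \<Sum>i\<in>closed_nbhd P j. a j i)"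
proof -
  have "(\<Sum>i\<in>UNIV. \<Sum>j\<in>{j \<in> UNIV. j \<in> closed_nbhd P i}. a j i)
      = (\<Sum>j\<in>UNIV. \<Sum>i\<in>{i \<in> UNIV. j \<in> closed_nbhd P i}. a j i)"
    by (rule sum.swap_restrict) auto
  moreover have "{i. j \<in> closed_nbhd P i} = closed_nbhd P j" for j
    using mem_closed_nbhd_commute[of j P] by auto
  ultimately show ?thesis by simp
qed

lemma weight_pos: "0 < weight (P :: ('v::finite, 'n::finite, 'm::finite) network_problem) j"
proof -
  have "0 < card (closed_nbhd P j)" by (simp add: card_gt_0_iff closed_nbhd_def)
  also have "\<dots> \<le> Max ((\<lambda>l. card (closed_nbhd P l)) ` closed_nbhd P j)"
    by (rule Max_ge) (auto simp: closed_nbhd_def)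
  finally show ?thesis by (simp add: weight_def)
qed

text \<open>
  Node \<open>i\<close> is itself a member of the closed neighbourhood of each of its neighbours \<open>j\<close>, so the maximum that
  defines the weight of \<open>j\<close> is at least the size of the closed neighbourhood of \<open>i\<close>.
\<close>

lemma sum_weight_le_1:
  fixes P :: "('v::finite, 'n::finite, 'm::finite) network_problem"
  shows "(\<Sum>j\<in>closed_nbhd P i. weight P j) \<le> 1"
proof -
  have c: "0 < card (closed_nbhd P i)" by (simp add: card_gt_0_iff closed_nbhd_def)
  have "weight P j \<le> 1 / real (card (closed_nbhd P i))" if "j \<in> closed_nbhd P i" for j
  proof -
    have "card (closed_nbhd P i) \<le> Max ((\<lambda>l. card (closed_nbhd P l)) ` closed_nbhd P j)"
      using that by (intro Max_ge) (auto simp: mem_closed_nbhd_commute[of j])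
    thus ?thesis unfolding weight_def using c by (intro divide_left_mono) auto
  qed
  hence "(\<Sum>j\<in>closed_nbhd P i. weight P j) \<le> (\<Sum>j\<in>closed_nbhd P i. 1 / real (card (closed_nbhd P i)))"
    by (rule sum_mono)
  also have "\<dots> = 1" using c by auto
  finally show ?thesis .
qed

lemma weight_le_1: "weight (P :: ('v::finite, 'n::finite, 'm::finite) network_problem) j \<le> 1"
proof -
  have "weight P j \<le> (\<Sum>l\<in>closed_nbhd P j. weight P l)"
    by (rule member_le_sum) (auto simp: closed_nbhd_def intro: less_imp_le[OF weight_pos])
  thus ?thesis using sum_weight_le_1[of P j] by linarith
qed

lemma subspace_reach_space: "subspace (reach_space P i)"
proof -
  have "(\<Sum>j\<in>J. coeff P *v block P j (u + v)) = (\<Sum>j\<in>J. coeff P *v block P j u) + (\<Sum>j\<in>J. coeff P *v block P j v)"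
    for J u v by (simp add: block_simps matrix_vector_right_distrib sum.distrib)
  moreover have "(\<Sum>j\<in>J. coeff P *v block P j (c *\<^sub>R u)) = c *\<^sub>R (\<Sum>j\<in>J. coeff P *v block P j u)" for J u c
    by (simp add: block_simps matrix_vector_mult_scaleR scaleR_sum_right)
  ultimately show ?thesis
    by (auto simp: subspace_def reach_space_def block_simps)
qed

section \<open>The decrease achieved by one DFM step\<close>

locale smooth_network =
  fixes P :: "('v::finite, 'n::finite, 'm::finite) network_problem"
    and L :: "'v \<Rightarrow> real" and \<beta> \<beta>\<^sub>1 :: real
  assumes assumption1: "assumption1 P L \<beta> \<beta>\<^sub>1"
begin

abbreviation "E \<equiv> block_space P"
abbreviation "X \<equiv> loc_set_strict P"
abbreviation "obj_grad i \<equiv> grad_on (E i) (loc_obj P i)"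
abbreviation "constr_grad i j \<equiv> grad_on (E i) (constr P i j)"

definition barrier_grad :: "'v \<Rightarrow> real ^ 'n \<Rightarrow> real ^ 'n" where
  "barrier_grad i x = (\<Sum>j=1..n_constr P i. (1 / (constr P i j x)\<^sup>2) *\<^sub>R constr_grad i j x)"

lemma L_pos: "0 < L i" and loc_obj_smooth: "smooth_fun_on (E i) (L i) (loc_obj P i)"
  using assumption1 by (auto simp: assumption1_def)

lemma loc_obj_diff: "loc_obj P i differentiable_on E i"
  using loc_obj_smooth by (simp add: smooth_fun_on_def)

lemma
  assumes "j \<in> {1..n_constr P i}"
  shows constr_convex: "convex_on (E i) (constr P i j)"
    and constr_smooth: "smooth_fun_on (E i) \<beta> (constr P i j)"
    and constr_lipschitz: "\<beta>\<^sub>1-lipschitz_on (loc_set P i) (constr P i j)"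
    and constr_diff: "constr P i j differentiable_on E i"
    and \<beta>_nonneg: "0 \<le> \<beta>"
  using assumption1 assms by (auto simp: assumption1_def smooth_fun_on_def lipschitz_on_def)

lemma convex_loc_set_strict: "convex (X i)"
proof -
  have "X i = E i \<inter> (\<Inter>j\<in>{1..n_constr P i}. {x \<in> E i. constr P i j x < 0})"
    by (auto simp: loc_set_strict_def)
  also have "convex \<dots>"
    by (intro convex_Int convex_INT subspace_imp_convex subspace_block_space convex_on_strict_sublevel constr_convex)
  finally show ?thesis .
qed

lemma loc_barrier_above_tangent:
  assumes "x \<in> X i" "z \<in> X i"
  shows "loc_barrier P i z \<ge> loc_barrier P i x + barrier_grad i x \<bullet> (z - x)"
proof -
  have "(\<Sum>j=1..n_constr P i. - (1 / constr P i j z))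
      \<ge> (\<Sum>j=1..n_constr P i. - (1 / constr P i j x) + ((1 / (constr P i j x)\<^sup>2) *\<^sub>R constr_grad i j x) \<bullet> (z - x))"
    using assms
    by (intro sum_mono inverse_barrier_above_tangent subspace_block_space constr_diff constr_convex)
       (auto simp: loc_set_strict_def)
  thus ?thesis
    by (simp add: loc_barrier_def barrier_grad_def sum_negf sum_subtractf inner_sum_left)
qed

lemma loc_barrier_nonneg: "x \<in> X i \<Longrightarrow> 0 \<le> loc_barrier P i x"
  unfolding loc_barrier_def neg_0_le_iff_le
  by (rule sum_nonpos) (auto simp: loc_set_strict_def divide_le_0_iff intro: less_imp_le)

text \<open>
  The Lipschitz constant of the constraints bounds their gradients only at strictly feasible points; this is
  enough, since \<open>x\<close> is strictly feasible and only gradients at \<open>x\<close> enter.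
\<close>

lemma loc_barrier_upper_bound:
  assumes x: "x \<in> X i" and u: "u \<in> E i" and \<delta>: "0 < \<delta>" "\<And>j. j \<in> {1..n_constr P i} \<Longrightarrow> constr P i j x \<le> - \<delta>"
    and small: "norm u \<le> 1" "(\<beta>\<^sub>1 + \<beta>) * norm u \<le> \<delta> / 2"
  shows "x + u \<in> X i"
    and "loc_barrier P i (x + u) \<le> loc_barrier P i x + barrier_grad i x \<bullet> u
          + real (n_constr P i) * (\<beta> / (2 * \<delta>\<^sup>2) + 2 * (\<beta>\<^sub>1 + \<beta>)\<^sup>2 / \<delta> ^ 3) * (norm u)\<^sup>2"
proof -
  let ?J = "{1..n_constr P i}"
  have xE: "x \<in> E i" using x by (simp add: loc_set_strict_def)
  have grad: "norm (constr_grad i j x) \<le> \<beta>\<^sub>1" if "j \<in> ?J" for j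
    using x constr_lipschitz[OF that] that
    by (intro norm_grad_on_le_lipschitz[of _ ?J] subspace_block_space constr_diff constr_convex)
       (auto simp: loc_set_strict_def loc_set_def)
  note * = inverse_barrier_upper_bound[OF subspace_block_space constr_smooth \<beta>_nonneg constr_convex
      grad xE u \<delta> small]
  have "constr P i j (x + u) < 0" if "j \<in> ?J" for j
    using *(1)[OF that that that that that] \<delta>(1) by simp
  thus "x + u \<in> X i"
    using xE u by (simp add: loc_set_strict_def subspace_add[OF subspace_block_space])
  have "(\<Sum>j\<in>?J. - (1 / constr P i j (x + u)))
      \<le> (\<Sum>j\<in>?J. - (1 / constr P i j x) + ((1 / (constr P i j x)\<^sup>2) *\<^sub>R constr_grad i j x) \<bullet> u
           + (\<beta> / (2 * \<delta>\<^sup>2) + 2 * (\<beta>\<^sub>1 + \<beta>)\<^sup>2 / \<delta> ^ 3) * (norm u)\<^sup>2)"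
    by (rule sum_mono) (rule *(2))
  thus "loc_barrier P i (x + u) \<le> loc_barrier P i x + barrier_grad i x \<bullet> u
          + real (n_constr P i) * (\<beta> / (2 * \<delta>\<^sup>2) + 2 * (\<beta>\<^sub>1 + \<beta>)\<^sup>2 / \<delta> ^ 3) * (norm u)\<^sup>2"
    by (simp add: loc_barrier_def barrier_grad_def sum_negf sum_subtractf sum.distrib inner_sum_left mult.assoc)
qed

text \<open>
  The summand of block \<open>i\<close> in the subproblems, as a function of the new position of that block.
\<close>

definition local_model :: "real \<Rightarrow> 'v \<Rightarrow> real ^ 'n \<Rightarrow> real ^ 'n \<Rightarrow> real" where
  "local_model \<rho> i z y = upper_model P L i z y + \<rho> * loc_barrier P i y"

lemma local_model_self: "local_model \<rho> i z z = loc_obj P i z + \<rho> * loc_barrier P i z"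
  by (simp add: local_model_def upper_model_def)

lemma local_model_ge:
  "z \<in> E i \<Longrightarrow> y \<in> E i \<Longrightarrow> loc_obj P i y + \<rho> * loc_barrier P i y \<le> local_model \<rho> i z y"
  using smooth_fun_upper_bound[OF subspace_block_space loc_obj_smooth]
  by (simp add: local_model_def upper_model_def)

lemma local_model_convex:
  assumes "0 \<le> \<rho>"
  shows "convex_on (X i) (local_model \<rho> i z)"
proof (rule convex_on_if_tangent[OF convex_loc_set_strict])
  fix x y assume xy: "x \<in> X i" "y \<in> X i"
  have "(norm (y - z))\<^sup>2 = (norm (x - z))\<^sup>2 + 2 * ((x - z) \<bullet> (y - x)) + (norm (y - x))\<^sup>2"
    by (simp add: power2_norm_eq_inner inner_simps inner_commute)
  hence "L i / 2 * (norm (y - z))\<^sup>2 = L i / 2 * (norm (x - z))\<^sup>2 + L i * ((x - z) \<bullet> (y - x)) + L i / 2 * (norm (y - x))\<^sup>2"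
    by (simp only:) (simp add: field_simps del: inner_diff_left inner_diff_right)
  moreover have "L i / 2 * (norm (y - x))\<^sup>2 \<ge> 0" using L_pos[of i] by simp
  ultimately have "L i / 2 * (norm (y - z))\<^sup>2 \<ge> L i / 2 * (norm (x - z))\<^sup>2 + L i * ((x - z) \<bullet> (y - x))"
    by linarith
  moreover have "\<rho> * loc_barrier P i y \<ge> \<rho> * loc_barrier P i x + \<rho> * (barrier_grad i x \<bullet> (y - x))"
    using mult_left_mono[OF loc_barrier_above_tangent[OF xy] assms] by (simp add: distrib_left)
  ultimately show "local_model \<rho> i z y \<ge> local_model \<rho> i z x
      + (obj_grad i z + L i *\<^sub>R (x - z) + \<rho> *\<^sub>R barrier_grad i x) \<bullet> (y - x)"
    unfolding local_model_def upper_model_def inner_add_left inner_scaleR_left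
    by (simp add: inner_diff_right)
qed

lemma bar_feasible_block: "x \<in> bar_feasible P \<Longrightarrow> block P i x \<in> X i"
  by (simp add: bar_feasible_def)

lemma bar_objective_alt:
  "bar_objective P \<rho> x = (\<Sum>i\<in>UNIV. loc_obj P i (block P i x) + \<rho> * loc_barrier P i (block P i x))"
  by (simp add: bar_objective_def objective_def barrier_def sum.distrib sum_distrib_left)

lemma barrier_nonneg: "x \<in> bar_feasible P \<Longrightarrow> 0 \<le> barrier P x"
  unfolding barrier_def by (intro sum_nonneg loc_barrier_nonneg bar_feasible_block)

text \<open>
  Everything is separable over the blocks.  In each block, Jensen's inequality for the local model bounds the new
  value by a weighted sum of changes, one for each neighbour; regrouping these changes by the node that proposed
  them gives the decreases of the subproblems.
\<close>

lemma dfm_step: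
  assumes x: "x \<in> bar_feasible P" and \<rho>: "0 \<le> \<rho>"
    and p: "\<And>i. p i \<in> subproblem_feasible P x i"
    and x': "\<And>i. block P i x' = block P i x + (\<Sum>j\<in>closed_nbhd P i. weight P j *\<^sub>R p j i)"
  shows "x' \<in> bar_feasible P"
    and "bar_objective P \<rho> x' \<le> bar_objective P \<rho> x
           + (\<Sum>j\<in>UNIV. weight P j * (subproblem_obj P L \<rho> x j (p j) - subproblem_obj P L \<rho> x j (\<lambda>_. 0)))"
proof -
  have pX: "block P i x + p j i \<in> X i" if "j \<in> closed_nbhd P i" for i j
    using p[of j] that by (auto simp: subproblem_feasible_def mem_closed_nbhd_commute[of j])
  have block: "block P i x' \<in> X i" for i
    unfolding x' using pX weight_pos[of P] bar_feasible_block[OF x]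
    by (intro convex_weighted_displacements convex_loc_set_strict sum_weight_le_1) (auto intro: less_imp_le)
  have "coeff P *v x' = (\<Sum>i\<in>UNIV. coeff P *v block P i x')" by (simp add: coeff_sum_blocks)
  also have "\<dots> = (\<Sum>i\<in>UNIV. coeff P *v block P i x)
      + (\<Sum>i\<in>UNIV. \<Sum>j\<in>closed_nbhd P i. weight P j *\<^sub>R (coeff P *v p j i))"
    by (simp add: x' matrix_vector_right_distrib sum.distrib linear_sum matrix_vector_mult_scaleR)
  also have "(\<Sum>i\<in>UNIV. \<Sum>j\<in>closed_nbhd P i. weight P j *\<^sub>R (coeff P *v p j i))
      = (\<Sum>j\<in>UNIV. weight P j *\<^sub>R (\<Sum>i\<in>closed_nbhd P j. coeff P *v p j i))"
    by (subst sum_closed_nbhd_swap) (simp add: scaleR_sum_right)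
  also have "\<dots> = 0" using p by (simp add: subproblem_feasible_def)
  finally have "coeff P *v x' = rhs P" using x by (simp add: coeff_sum_blocks bar_feasible_def)
  with block show x'_feas: "x' \<in> bar_feasible P" by (simp add: bar_feasible_def)
  let ?M = "\<lambda>i. local_model \<rho> i (block P i x)"
  have "bar_objective P \<rho> x' \<le> (\<Sum>i\<in>UNIV. ?M i (block P i x'))"
    unfolding bar_objective_alt by (intro sum_mono local_model_ge) auto
  also have "\<dots> \<le> (\<Sum>i\<in>UNIV. ?M i (block P i x)
      + (\<Sum>j\<in>closed_nbhd P i. weight P j * (?M i (block P i x + p j i) - ?M i (block P i x))))"
    unfolding x' using pX weight_pos[of P] bar_feasible_block[OF x]
    by (intro sum_mono convex_on_weighted_displacements[OF local_model_convex[OF \<rho>]] sum_weight_le_1)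
       (auto intro: less_imp_le)
  also have "\<dots> = bar_objective P \<rho> x + (\<Sum>j\<in>UNIV. \<Sum>i\<in>closed_nbhd P j.
      weight P j * (?M i (block P i x + p j i) - ?M i (block P i x)))"
    unfolding bar_objective_alt local_model_self sum.distrib
    by (subst sum_closed_nbhd_swap) (rule refl)
  also have "\<dots> = bar_objective P \<rho> x
           + (\<Sum>j\<in>UNIV. weight P j * (subproblem_obj P L \<rho> x j (p j) - subproblem_obj P L \<rho> x j (\<lambda>_. 0)))"
    by (simp add: subproblem_obj_def local_model_def sum_subtractf sum_distrib_left[symmetric])
  finally show "bar_objective P \<rho> x' \<le> bar_objective P \<rho> x
           + (\<Sum>j\<in>UNIV. weight P j * (subproblem_obj P L \<rho> x j (p j) - subproblem_obj P L \<rho> x j (\<lambda>_. 0)))" .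
qed

definition bar_grad :: "real \<Rightarrow> real ^ 'n \<Rightarrow> real ^ 'n" where
  "bar_grad \<rho> x = (\<Sum>i\<in>UNIV. obj_grad i (block P i x) + \<rho> *\<^sub>R barrier_grad i (block P i x))"

text \<open>
  The common form of the two convexity assumptions: \<open>\<sigma> = 0\<close> expresses convexity.
\<close>

definition tangent_lower :: "real \<Rightarrow> bool" where
  "tangent_lower \<sigma> \<longleftrightarrow> (\<forall>i. \<forall>x\<in>E i. \<forall>y\<in>E i.
     loc_obj P i y \<ge> loc_obj P i x + obj_grad i x \<bullet> (y - x) + \<sigma> / 2 * (norm (y - x))\<^sup>2)"

definition dfm_update :: "real \<Rightarrow> real ^ 'n \<Rightarrow> real ^ 'n \<Rightarrow> bool" where
  "dfm_update \<rho> x x' \<longleftrightarrow> (\<exists>p.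
     (\<forall>i. is_arg_min (subproblem_obj P L \<rho> x i) (\<lambda>r. r \<in> subproblem_feasible P x i) (p i)) \<and>
     (\<forall>i. block P i x' = block P i x + (\<Sum>j\<in>closed_nbhd P i. weight P j *\<^sub>R p j i)))"

lemma dfm_run_iff: "dfm_run P L \<rho> x0 x \<longleftrightarrow> x 0 = x0 \<and> (\<forall>k. dfm_update \<rho> (x k) (x (Suc k)))"
  by (simp add: dfm_run_def dfm_update_def)

lemma barrier_grad_mem: "x \<in> E i \<Longrightarrow> barrier_grad i x \<in> E i"
  unfolding barrier_grad_def
  by (intro subspace_sum subspace_scale subspace_block_space grad_on_mem constr_diff)

lemma obj_grad_mem: "x \<in> E i \<Longrightarrow> obj_grad i x \<in> E i"
  by (intro subspace_block_space grad_on_mem loc_obj_diff)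

lemma bar_grad_inner:
  "bar_grad \<rho> x \<bullet> u = (\<Sum>i\<in>UNIV. obj_grad i (block P i x) \<bullet> block P i u
                          + \<rho> * (barrier_grad i (block P i x) \<bullet> block P i u))"
  by (simp add: bar_grad_def inner_sum_left inner_add_left inner_block barrier_grad_mem obj_grad_mem)

lemma bar_objective_above_tangent:
  assumes "tangent_lower \<sigma>" "0 \<le> \<rho>" "x \<in> bar_feasible P" "z \<in> bar_feasible P"
  shows "bar_objective P \<rho> z \<ge> bar_objective P \<rho> x + bar_grad \<rho> x \<bullet> (z - x) + \<sigma> / 2 * (norm (z - x))\<^sup>2"
proof -
  let ?b = "\<lambda>i. block P i"
  have "bar_objective P \<rho> x + bar_grad \<rho> x \<bullet> (z - x) + \<sigma> / 2 * (norm (z - x))\<^sup>2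
      = (\<Sum>i\<in>UNIV. (loc_obj P i (?b i x) + obj_grad i (?b i x) \<bullet> (?b i z - ?b i x) + \<sigma> / 2 * (norm (?b i z - ?b i x))\<^sup>2)
         + \<rho> * (loc_barrier P i (?b i x) + barrier_grad i (?b i x) \<bullet> (?b i z - ?b i x)))"
    unfolding bar_objective_alt bar_grad_inner sum_norm_block_squared[of P "z - x", symmetric] sum_distrib_left
    by (simp add: sum.distrib[symmetric] block_simps algebra_simps)
  also have "\<dots> \<le> bar_objective P \<rho> z"
    unfolding bar_objective_alt using assms
    by (intro sum_mono add_mono mult_left_mono loc_barrier_above_tangent bar_feasible_block)
       (auto simp: tangent_lower_def)
  finally show ?thesis .
qed

text \<open>
  The blocks of a short enough vector of \<open>S\<^sub>j\<close> form an admissible decision of node \<open>j\<close>, and to first order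
  the subproblem changes by the full inner product with \<open>\<nabla>F(x)\<close>, because the remaining blocks vanish.
\<close>

lemma subproblem_decrease:
  assumes x: "x \<in> bar_feasible P" and \<rho>: "0 \<le> \<rho>" and u: "u \<in> reach_space P j"
    and \<delta>: "0 < \<delta>" "\<And>i l. l \<in> {1..n_constr P i} \<Longrightarrow> constr P i l (block P i x) \<le> - \<delta>"
    and small: "norm u \<le> 1" "(\<beta>\<^sub>1 + \<beta>) * norm u \<le> \<delta> / 2" and \<beta>: "0 \<le> \<beta>\<^sub>1 + \<beta>"
    and C: "\<And>i. L i / 2 + \<rho> * (real (n_constr P i) * (\<beta> / (2 * \<delta>\<^sup>2) + 2 * (\<beta>\<^sub>1 + \<beta>)\<^sup>2 / \<delta> ^ 3)) \<le> C"
  shows "(\<lambda>i. block P i u) \<in> subproblem_feasible P x j"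
    and "subproblem_obj P L \<rho> x j (\<lambda>i. block P i u) - subproblem_obj P L \<rho> x j (\<lambda>_. 0)
           \<le> bar_grad \<rho> x \<bullet> u + C * (norm u)\<^sup>2"
proof -
  have nb: "norm (block P i u) \<le> 1" "(\<beta>\<^sub>1 + \<beta>) * norm (block P i u) \<le> \<delta> / 2" for i
    using norm_block_le[of P i u] small mult_left_mono[OF norm_block_le[of P i u] \<beta>] by linarith+
  note up = loc_barrier_upper_bound[OF bar_feasible_block[OF x] block_mem \<delta> nb]
  show "(\<lambda>i. block P i u) \<in> subproblem_feasible P x j"
    using up(1) u by (auto simp: subproblem_feasible_def reach_space_def)
  let ?q = "\<lambda>i. real (n_constr P i) * (\<beta> / (2 * \<delta>\<^sup>2) + 2 * (\<beta>\<^sub>1 + \<beta>)\<^sup>2 / \<delta> ^ 3)"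
  let ?D = "\<lambda>i. obj_grad i (block P i x) \<bullet> block P i u + \<rho> * (barrier_grad i (block P i x) \<bullet> block P i u)
              + C * (norm (block P i u))\<^sup>2"
  have "subproblem_obj P L \<rho> x j (\<lambda>i. block P i u) - subproblem_obj P L \<rho> x j (\<lambda>_. 0)
      = (\<Sum>i\<in>closed_nbhd P j. obj_grad i (block P i x) \<bullet> block P i u + L i / 2 * (norm (block P i u))\<^sup>2
           + \<rho> * (loc_barrier P i (block P i x + block P i u) - loc_barrier P i (block P i x)))"
    by (simp add: subproblem_obj_def upper_model_def sum_subtractf[symmetric] algebra_simps)
  also have "\<dots> \<le> (\<Sum>i\<in>closed_nbhd P j. ?D i)"
  proof (rule sum_mono)
    fix i
    have "\<rho> * (loc_barrier P i (block P i x + block P i u) - loc_barrier P i (block P i x))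
        \<le> \<rho> * (barrier_grad i (block P i x) \<bullet> block P i u + ?q i * (norm (block P i u))\<^sup>2)"
      using up(2)[of i] \<rho> by (intro mult_left_mono) auto
    moreover have "(L i / 2 + \<rho> * ?q i) * (norm (block P i u))\<^sup>2 \<le> C * (norm (block P i u))\<^sup>2"
      using C[of i] by (intro mult_right_mono) auto
    ultimately show "obj_grad i (block P i x) \<bullet> block P i u + L i / 2 * (norm (block P i u))\<^sup>2
           + \<rho> * (loc_barrier P i (block P i x + block P i u) - loc_barrier P i (block P i x)) \<le> ?D i"
      unfolding distrib_right distrib_left mult.assoc by linarith
  qed
  also have "\<dots> = (\<Sum>i\<in>UNIV. ?D i)"
    using u by (intro sum.mono_neutral_left) (auto simp: reach_space_def)
  also have "\<dots> = bar_grad \<rho> x \<bullet> u + C * (norm u)\<^sup>2"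
    unfolding bar_grad_inner sum_norm_block_squared[of P u, symmetric] sum_distrib_left sum.distrib ..
  finally show "subproblem_obj P L \<rho> x j (\<lambda>i. block P i u) - subproblem_obj P L \<rho> x j (\<lambda>_. 0)
           \<le> bar_grad \<rho> x \<bullet> u + C * (norm u)\<^sup>2" .
qed

lemma dfm_update_feasible:
  assumes "x \<in> bar_feasible P" "0 \<le> \<rho>" "dfm_update \<rho> x x'"
  shows "x' \<in> bar_feasible P"
  using assms by (auto simp: dfm_update_def is_arg_min_def intro: dfm_step(1))

text \<open>
  Node \<open>j\<close> is compared with \<open>(s / \<eta>\<^sub>j) u\<^sub>j\<close>.  The weight \<open>\<eta>\<^sub>j\<close> in front of its decrease cancels in the first-order
  term, so that these terms add up to the inner product with the whole sum of the \<open>u\<^sub>j\<close>.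
\<close>

lemma dfm_update_decrease:
  assumes x: "x \<in> bar_feasible P" and \<rho>: "0 \<le> \<rho>" and step: "dfm_update \<rho> x x'"
    and u: "\<And>j. u j \<in> reach_space P j"
    and bound: "\<And>j. norm (u j) \<le> \<kappa> * weight P j * d" and s: "0 \<le> s" "s * (\<kappa> * d) \<le> r"
    and \<delta>: "0 < \<delta>" "\<And>i l. l \<in> {1..n_constr P i} \<Longrightarrow> constr P i l (block P i x) \<le> - \<delta>"
    and r: "r \<le> 1" "(\<beta>\<^sub>1 + \<beta>) * r \<le> \<delta> / 2" and \<beta>: "0 \<le> \<beta>\<^sub>1 + \<beta>" and C0: "0 \<le> C"
    and C: "\<And>i. L i / 2 + \<rho> * (real (n_constr P i) * (\<beta> / (2 * \<delta>\<^sup>2) + 2 * (\<beta>\<^sub>1 + \<beta>)\<^sup>2 / \<delta> ^ 3)) \<le> C"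
  shows "bar_objective P \<rho> x' \<le> bar_objective P \<rho> x + s * (bar_grad \<rho> x \<bullet> (\<Sum>j\<in>UNIV. u j))
           + C * real CARD('v) * (s * (\<kappa> * d))\<^sup>2"
proof -
  obtain p where
    min: "\<And>i. is_arg_min (subproblem_obj P L \<rho> x i) (\<lambda>r. r \<in> subproblem_feasible P x i) (p i)"
    and x': "\<And>i. block P i x' = block P i x + (\<Sum>j\<in>closed_nbhd P i. weight P j *\<^sub>R p j i)"
    using step by (auto simp: dfm_update_def)
  have p: "p i \<in> subproblem_feasible P x i" for i using min[of i] by (simp add: is_arg_min_def)
  let ?D = "\<lambda>j p. subproblem_obj P L \<rho> x j p - subproblem_obj P L \<rho> x j (\<lambda>_. 0)"
  have "weight P j * ?D j (p j) \<le> s * (bar_grad \<rho> x \<bullet> u j) + C * (s * (\<kappa> * d))\<^sup>2" for j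
  proof -
    note w = weight_pos[of P j]
    define v where "v = (s / weight P j) *\<^sub>R u j"
    have v: "v \<in> reach_space P j" unfolding v_def by (rule subspace_scale[OF subspace_reach_space u])
    have "norm v = (s / weight P j) * norm (u j)" using s w by (simp add: v_def)
    also have "\<dots> \<le> (s / weight P j) * (\<kappa> * weight P j * d)" using bound s w by (intro mult_left_mono) auto
    also have "\<dots> = s * (\<kappa> * d)" using w by simp
    finally have nv: "norm v \<le> s * (\<kappa> * d)" .
    hence small: "norm v \<le> 1" "(\<beta>\<^sub>1 + \<beta>) * norm v \<le> \<delta> / 2"
      using s r mult_left_mono[of "norm v" r, OF _ \<beta>] by linarith+
    note dec = subproblem_decrease[OF x \<rho> v \<delta> small \<beta> C]
    have "?D j (p j) \<le> ?D j (\<lambda>i. block P i v)"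
      using min[of j] dec(1) by (simp add: is_arg_min_linorder)
    also note dec(2)
    finally have "weight P j * ?D j (p j) \<le> weight P j * (bar_grad \<rho> x \<bullet> v + C * (norm v)\<^sup>2)"
      using w by (intro mult_left_mono) auto
    also have "\<dots> = s * (bar_grad \<rho> x \<bullet> u j) + weight P j * (C * (norm v)\<^sup>2)"
      using w by (simp add: v_def distrib_left)
    also have "weight P j * (C * (norm v)\<^sup>2) \<le> 1 * (C * (s * (\<kappa> * d))\<^sup>2)"
      using weight_le_1[of P j] w C0 nv by (intro mult_mono power_mono) auto
    finally show ?thesis by simp
  qed
  hence "(\<Sum>j\<in>UNIV. weight P j * ?D j (p j)) \<le> (\<Sum>j\<in>UNIV. s * (bar_grad \<rho> x \<bullet> u j) + C * (s * (\<kappa> * d))\<^sup>2)"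
    by (rule sum_mono)
  also have "\<dots> = s * (bar_grad \<rho> x \<bullet> (\<Sum>j\<in>UNIV. u j)) + C * real CARD('v) * (s * (\<kappa> * d))\<^sup>2"
    by (simp add: sum.distrib sum_distrib_left inner_sum_right)
  finally show ?thesis using dfm_step(2)[OF x \<rho> p x'] by simp
qed

lemma convex_bar_feasible: "convex (bar_feasible P)"
proof -
  have "bar_feasible P = (\<Inter>i. block P i -` X i) \<inter> {x. coeff P *v x = rhs P}"
    by (auto simp: bar_feasible_def)
  also have "convex \<dots>"
  proof (intro convex_Int convex_INT convex_linear_vimage linear_block convex_loc_set_strict)
    show "convex {x. coeff P *v x = rhs P}"
      by (rule convex_coeff_constraint)
  qed
  finally show ?thesis .
qed

lemma objective_alt: "objective P = bar_objective P 0"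
  by (simp add: bar_objective_def fun_eq_iff)

lemma objective_convex:
  assumes conv: "\<And>i. convex_on (E i) (loc_obj P i)"
  shows "convex_on UNIV (objective P)"
proof (rule convex_onI)
  fix t :: real and x y assume t: "0 < t" "t < 1"
  have "objective P ((1 - t) *\<^sub>R x + t *\<^sub>R y)
      = (\<Sum>i\<in>UNIV. loc_obj P i ((1 - t) *\<^sub>R block P i x + t *\<^sub>R block P i y))"
    by (simp add: objective_def block_simps)
  also have "\<dots> \<le> (\<Sum>i\<in>UNIV. (1 - t) * loc_obj P i (block P i x) + t * loc_obj P i (block P i y))"
    using t by (intro sum_mono convex_onD[OF conv]) auto
  also have "\<dots> = (1 - t) * objective P x + t * objective P y"
    by (simp add: objective_def sum.distrib sum_distrib_left)
  finally show "objective P ((1 - t) *\<^sub>R x + t *\<^sub>R y) \<le> (1 - t) * objective P x + t * objective P y" .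
qed simp

lemma continuous_on_objective: "continuous_on UNIV (objective P)"
proof -
  have "continuous_on UNIV (\<lambda>x. loc_obj P i (block P i x))" for i
    by (intro continuous_on_block differentiable_imp_continuous_on loc_obj_diff)
  thus ?thesis unfolding objective_def by (intro continuous_on_sum) auto
qed

lemma closed_feasible: "closed (feasible P)"
proof -
  have "feasible P = (\<Inter>i. \<Inter>j\<in>{1..n_constr P i}. {x. constr P i j (block P i x) \<le> 0}) \<inter> {x. coeff P *v x = rhs P}"
    by (auto simp: feasible_def loc_set_def coeff_sum_blocks)
  also have "closed \<dots>"
  proof (intro closed_Int closed_INT ballI)
    fix i j assume "j \<in> {1..n_constr P i}"
    hence "continuous_on UNIV (\<lambda>x. constr P i j (block P i x))"
      by (intro continuous_on_block differentiable_imp_continuous_on constr_diff)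
    thus "closed {x. constr P i j (block P i x) \<le> 0}" by (intro closed_Collect_le continuous_on_const)
  next
    have "continuous_on UNIV (\<lambda>x. coeff P *v x)"
      by (intro linear_continuous_on linear_conv_bounded_linear[THEN iffD1] matrix_vector_mul_linear)
    thus "closed {x. coeff P *v x = rhs P}" by (intro closed_Collect_eq continuous_on_const)
  qed
  finally show ?thesis .
qed

lemma convex_feasible: "convex (feasible P)"
proof -
  have "feasible P = (\<Inter>i. \<Inter>j\<in>{1..n_constr P i}. {x. constr P i j (block P i x) \<le> 0}) \<inter> {x. coeff P *v x = rhs P}"
    by (auto simp: feasible_def loc_set_def coeff_sum_blocks)
  also have "convex \<dots>"
  proof (intro convex_Int convex_INT)
    fix i j assume j: "j \<in> {1..n_constr P i}"
    show "convex {x. constr P i j (block P i x) \<le> 0}"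
    proof (rule convexI)
      fix x y and u v :: real
      assume xy: "x \<in> {x. constr P i j (block P i x) \<le> 0}" "y \<in> {x. constr P i j (block P i x) \<le> 0}"
        and uv: "0 \<le> u" "0 \<le> v" "u + v = 1"
      have "constr P i j (block P i (u *\<^sub>R x + v *\<^sub>R y)) \<le> u * constr P i j (block P i x) + v * constr P i j (block P i y)"
        using constr_convex[OF j] uv by (simp add: block_simps convex_on_def)
      also have "\<dots> \<le> 0" using xy uv by (intro convex_bound_le) auto
      finally show "u *\<^sub>R x + v *\<^sub>R y \<in> {x. constr P i j (block P i x) \<le> 0}" by simp
    qed
  next
    show "convex {x. coeff P *v x = rhs P}"
      by (rule convex_coeff_constraint)
  qed
  finally show ?thesis .
qed

end

section \<open>Progress with the barrier parameter tied to the accuracy\<close>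

locale barrier_dfm = smooth_network P L \<beta> \<beta>\<^sub>1
  for P :: "('v::finite, 'n::finite, 'm::finite) network_problem" and L \<beta> \<beta>\<^sub>1 +
  fixes x0 :: "real ^ 'n" and flow :: real
  assumes assumption2: "assumption2 P"
    and x0: "x0 \<in> bar_feasible P"
    and barrier_x0: "barrier P x0 \<noteq> 0"
    and flow: "flow \<le> opt_value P"
begin

abbreviation "\<rho> \<equiv> barrier_param P x0 flow"
abbreviation "F \<epsilon> \<equiv> bar_objective P (\<rho> \<epsilon>)"

definition "gap0 = objective P x0 - opt_value P"

text \<open>
  The quotient \<open>\<rho> / \<epsilon>\<^sup>2\<close>.
\<close>

definition "barrier_rate = 1 / (4 * (objective P x0 - flow) * barrier P x0)"

lemma bar_feasible_feasible: "x \<in> bar_feasible P \<Longrightarrow> x \<in> feasible P"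
  by (auto simp: bar_feasible_def feasible_def coeff_sum_blocks loc_set_def loc_set_strict_def less_imp_le)

lemma opt_value_le: "x \<in> feasible P \<Longrightarrow> opt_value P \<le> objective P x"
  using assumption1 unfolding opt_value_def assumption1_def by (intro cINF_lower) auto

lemma barrier_x0_pos: "0 < barrier P x0"
  using barrier_nonneg[OF x0] barrier_x0 by simp

lemma \<beta>s_nonneg: "0 \<le> \<beta>" "0 \<le> \<beta>\<^sub>1"
proof -
  obtain i where "n_constr P i \<noteq> 0"
    using barrier_x0 by (force simp: barrier_def loc_barrier_def)
  hence j: "1 \<in> {1..n_constr P i}" by simp
  show "0 \<le> \<beta>" by (rule \<beta>_nonneg[OF j])
  show "0 \<le> \<beta>\<^sub>1" using constr_lipschitz[OF j] by (simp add: lipschitz_on_def)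
qed

text \<open>
  One step at an iterate \<open>x\<close> makes progress towards every strictly feasible \<open>z\<close>, with constants that do not
  depend on \<open>\<epsilon>\<close>.  The weighted sum of the competitors is \<open>s (z - x)\<close>, and the free parameter \<open>s\<close> has to be
  small enough for them to keep the constraints at depth of order \<open>\<epsilon>\<^sup>2\<close>.
\<close>

definition progress_bound :: "real \<Rightarrow> real \<Rightarrow> bool" where
  "progress_bound A b \<longleftrightarrow> (\<forall>\<epsilon> x x' z \<sigma> s.
      \<epsilon> \<in> eps_range P x0 \<longrightarrow> tangent_lower \<sigma> \<longrightarrow> x \<in> bar_feasible P \<longrightarrow> F \<epsilon> x \<le> F \<epsilon> x0
      \<longrightarrow> dfm_update (\<rho> \<epsilon>) x x' \<longrightarrow> z \<in> bar_feasible P \<longrightarrow> 0 \<le> s \<longrightarrow> s * norm (z - x) \<le> b * \<epsilon>\<^sup>2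
      \<longrightarrow> F \<epsilon> x' \<le> F \<epsilon> x - s * (F \<epsilon> x - F \<epsilon> z + \<sigma> / 2 * (norm (z - x))\<^sup>2)
                    + A / \<epsilon> ^ 4 * (s * norm (z - x))\<^sup>2)"

text \<open>
  The constant in the quadratic bound for the subproblems: for \<open>\<rho> = \<epsilon>\<^sup>2 r\<close> and \<open>\<delta> = \<rho> / (2 \<Delta>)\<close>, with \<open>r\<close> the barrier
  rate and \<open>\<Delta>\<close> the initial gap, each of the terms \<open>L i / 2\<close>, \<open>\<rho> \<beta> / (2 \<delta>\<^sup>2)\<close> and \<open>2 \<rho> (\<beta>\<^sub>1 + \<beta>)\<^sup>2 / \<delta>\<^sup>3\<close> is at most
  a constant times \<open>\<epsilon>\<^sup>-\<^sup>4\<close> as long as \<open>\<epsilon> \<le> 2 \<Delta>\<close>.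
\<close>

definition "curvature = (\<Sum>i\<in>UNIV. 8 * L i * gap0 ^ 4 + real (n_constr P i) *
   (8 * \<beta> * gap0 ^ 4 / barrier_rate + 16 * (\<beta>\<^sub>1 + \<beta>)\<^sup>2 * gap0 ^ 3 / barrier_rate\<^sup>2))"

context
  assumes gap0_pos: "0 < gap0"
begin

lemma eps_rangeD: "\<epsilon> \<in> eps_range P x0 \<Longrightarrow> 0 < \<epsilon>" "\<epsilon> \<in> eps_range P x0 \<Longrightarrow> \<epsilon> < 2 * gap0"
  by (auto simp: eps_range_def gap0_def)

lemma barrier_rate_pos: "0 < barrier_rate"
  using gap0_pos flow barrier_x0_pos by (simp add: barrier_rate_def gap0_def)

lemma barrier_param_alt: "\<rho> \<epsilon> = \<epsilon>\<^sup>2 * barrier_rate"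
  by (simp add: barrier_param_def barrier_rate_def)

lemma barrier_param_pos: "\<epsilon> \<in> eps_range P x0 \<Longrightarrow> 0 < \<rho> \<epsilon>"
  using eps_rangeD(1)[of \<epsilon>] barrier_rate_pos by (simp add: barrier_param_alt)

lemma barrier_param_x0: "\<rho> \<epsilon> * barrier P x0 \<le> \<epsilon>\<^sup>2 / (4 * gap0)"
proof -
  have "\<rho> \<epsilon> * barrier P x0 = \<epsilon>\<^sup>2 / (4 * (objective P x0 - flow))"
    using barrier_x0_pos by (simp add: barrier_param_def)
  also have "\<dots> \<le> \<epsilon>\<^sup>2 / (4 * gap0)"
    using gap0_pos flow by (intro divide_left_mono mult_left_mono) (auto simp: gap0_def)
  finally show ?thesis .
qed

lemma F_x0_le:
  assumes "\<epsilon> \<in> eps_range P x0"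
  shows "F \<epsilon> x0 \<le> opt_value P + 2 * gap0"
proof -
  have "\<epsilon>\<^sup>2 \<le> (2 * gap0)\<^sup>2" using eps_rangeD[OF assms] by (intro power_mono) auto
  hence "\<epsilon>\<^sup>2 / (4 * gap0) \<le> (2 * gap0)\<^sup>2 / (4 * gap0)" using gap0_pos by (intro divide_right_mono) auto
  also have "\<dots> = gap0" using gap0_pos by (simp add: power2_eq_square)
  finally show ?thesis using barrier_param_x0[of \<epsilon>] by (simp add: bar_objective_def gap0_def)
qed

lemma objective_le_F: "\<epsilon> \<in> eps_range P x0 \<Longrightarrow> x \<in> bar_feasible P \<Longrightarrow> objective P x \<le> F \<epsilon> x"
  using barrier_param_pos[of \<epsilon>] barrier_nonneg[of x] by (simp add: bar_objective_def)

text \<open>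
  The sublevel bound limits \<open>\<rho> B(x)\<close> to \<open>F(x\<^sup>0) - f\<^sup>\<star>\<close>, at most twice the initial gap, and each single term
  \<open>-1/g\<close> is at most \<open>B(x)\<close>.
\<close>

lemma constr_bounded_away:
  assumes \<epsilon>: "\<epsilon> \<in> eps_range P x0" and x: "x \<in> bar_feasible P" "F \<epsilon> x \<le> F \<epsilon> x0"
    and j: "j \<in> {1..n_constr P i}"
  shows "constr P i j (block P i x) \<le> - (\<rho> \<epsilon> / (2 * gap0))"
proof -
  let ?g = "constr P i j (block P i x)"
  note \<rho> = barrier_param_pos[OF \<epsilon>]
  have neg: "constr P i l (block P i x) < 0" if "l \<in> {1..n_constr P i}" for l
    using bar_feasible_block[OF x(1), of i] that by (simp add: loc_set_strict_def)
  have "- (1 / ?g) \<le> (\<Sum>l\<in>{1..n_constr P i}. - (1 / constr P i l (block P i x)))"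
    using j neg by (intro member_le_sum) (auto simp: divide_le_0_iff intro: less_imp_le)
  also have "\<dots> = loc_barrier P i (block P i x)" by (simp add: loc_barrier_def sum_negf)
  also have "\<dots> \<le> barrier P x"
    unfolding barrier_def using x by (intro member_le_sum loc_barrier_nonneg bar_feasible_block) auto
  finally have "\<rho> \<epsilon> * (- (1 / ?g)) \<le> \<rho> \<epsilon> * barrier P x" using \<rho> by (intro mult_left_mono) auto
  also have "\<dots> = F \<epsilon> x - objective P x" by (simp add: bar_objective_def)
  also have "\<dots> \<le> 2 * gap0"
    using x F_x0_le[OF \<epsilon>] opt_value_le[OF bar_feasible_feasible[OF x(1)]] by linarith
  finally have "\<rho> \<epsilon> * (- (1 / ?g)) \<le> 2 * gap0" .
  thus ?thesis using neg[OF j] gap0_pos by (simp add: field_simps)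
qed

text \<open>
  The weights are put into the bound because the vector \<open>u j\<close> will be divided by the weight of \<open>j\<close>.
\<close>

lemma null_decomposition:
  obtains \<kappa> where "0 < \<kappa>"
    and "\<And>w. coeff P *v w = 0 \<Longrightarrow> \<exists>u. (\<forall>j. u j \<in> reach_space P j) \<and> w = (\<Sum>j\<in>UNIV. u j)
           \<and> (\<forall>j. norm (u j) \<le> \<kappa> * weight P j * norm w)"
proof -
  have null: "{(\<Sum>j\<in>UNIV. u j) | u. \<forall>j. u j \<in> reach_space P j} = {w. coeff P *v w = 0}"
    using assumption2 by (simp add: assumption2_def)
  obtain K where "0 \<le> K"
    "\<And>w. w \<in> {w. coeff P *v w = 0} \<Longrightarrow> \<exists>u. (\<forall>j. u j \<in> reach_space P j) \<and> w = (\<Sum>j\<in>UNIV. u j)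
           \<and> (\<forall>j. norm (u j) \<le> K * norm w)"
    using bounded_subspace_decomposition[of "reach_space P", OF subspace_reach_space, unfolded null] by metis
  hence K: "0 \<le> K"
    "\<And>w. coeff P *v w = 0 \<Longrightarrow> \<exists>u. (\<forall>j. u j \<in> reach_space P j) \<and> w = (\<Sum>j\<in>UNIV. u j)
           \<and> (\<forall>j. norm (u j) \<le> K * norm w)"
    by simp_all
  define \<kappa> where "\<kappa> = 1 + (\<Sum>j\<in>UNIV. K / weight P j)"
  have nn: "0 \<le> K / weight P j" for j using K(1) weight_pos[of P j] by simp
  show thesis
  proof (rule that[of \<kappa>])
    show "0 < \<kappa>" unfolding \<kappa>_def using nn by (intro add_pos_nonneg sum_nonneg) auto
  next
    fix w assume "coeff P *v w = 0"
    then obtain u where u: "\<forall>j. u j \<in> reach_space P j" "w = (\<Sum>j\<in>UNIV. u j)" "\<forall>j. norm (u j) \<le> K * norm w"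
      using K(2) by blast
    have "norm (u j) \<le> \<kappa> * weight P j * norm w" for j
    proof -
      have "K / weight P j \<le> (\<Sum>j\<in>UNIV. K / weight P j)" using nn by (intro member_le_sum) auto
      hence "K / weight P j \<le> \<kappa>" by (simp add: \<kappa>_def)
      hence "K \<le> \<kappa> * weight P j" using weight_pos[of P j] by (simp add: field_simps)
      hence "K * norm w \<le> \<kappa> * weight P j * norm w" by (intro mult_right_mono) auto
      thus ?thesis using u(3) by (meson order_trans)
    qed
    thus "\<exists>u. (\<forall>j. u j \<in> reach_space P j) \<and> w = (\<Sum>j\<in>UNIV. u j)
           \<and> (\<forall>j. norm (u j) \<le> \<kappa> * weight P j * norm w)" using u by blast
  qed
qed

lemma curvature_pos: "0 < curvature"
  unfolding curvature_def using L_pos gap0_pos barrier_rate_pos \<beta>s_nonneg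
  by (intro sum_pos add_pos_nonneg mult_nonneg_nonneg mult_pos_pos add_nonneg_nonneg divide_nonneg_nonneg) auto

lemma curvature_bound:
  assumes \<epsilon>: "\<epsilon> \<in> eps_range P x0" and \<delta>: "\<delta> = \<rho> \<epsilon> / (2 * gap0)"
  shows "L i / 2 + \<rho> \<epsilon> * (real (n_constr P i) * (\<beta> / (2 * \<delta>\<^sup>2) + 2 * (\<beta>\<^sub>1 + \<beta>)\<^sup>2 / \<delta> ^ 3))
     \<le> curvature / \<epsilon> ^ 4"
proof -
  note pos = eps_rangeD[OF \<epsilon>] gap0_pos barrier_rate_pos \<beta>s_nonneg
  have e4: "\<epsilon> ^ 4 \<le> 16 * gap0 ^ 4"
    using power_mono[of \<epsilon> "2 * gap0" 4] pos by (simp add: power_mult_distrib)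
  have e2: "\<epsilon>\<^sup>2 \<le> 4 * gap0\<^sup>2"
    using power_mono[of \<epsilon> "2 * gap0" 2] pos by (simp add: power_mult_distrib)
  have 1: "L i / 2 \<le> 8 * L i * gap0 ^ 4 / \<epsilon> ^ 4"
    using mult_left_mono[OF e4, of "L i / 2"] L_pos[of i] pos by (simp add: field_simps)
  have "\<rho> \<epsilon> * (\<beta> / (2 * \<delta>\<^sup>2)) = 2 * \<beta> * gap0\<^sup>2 * \<epsilon>\<^sup>2 / (barrier_rate * \<epsilon> ^ 4)"
    using pos unfolding \<delta> barrier_param_alt by (simp add: field_simps eval_nat_numeral)
  also have "\<dots> \<le> 2 * \<beta> * gap0\<^sup>2 * (4 * gap0\<^sup>2) / (barrier_rate * \<epsilon> ^ 4)"
    using pos e2 by (intro divide_right_mono mult_left_mono) auto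
  also have "\<dots> = (8 * \<beta> * gap0 ^ 4 / barrier_rate) / \<epsilon> ^ 4" by (simp add: eval_nat_numeral)
  finally have 2: "\<rho> \<epsilon> * (\<beta> / (2 * \<delta>\<^sup>2)) \<le> (8 * \<beta> * gap0 ^ 4 / barrier_rate) / \<epsilon> ^ 4" .
  have 3: "\<rho> \<epsilon> * (2 * (\<beta>\<^sub>1 + \<beta>)\<^sup>2 / \<delta> ^ 3) = (16 * (\<beta>\<^sub>1 + \<beta>)\<^sup>2 * gap0 ^ 3 / barrier_rate\<^sup>2) / \<epsilon> ^ 4"
    using pos unfolding \<delta> barrier_param_alt by (simp add: field_simps eval_nat_numeral)
  let ?c = "\<lambda>i. 8 * L i * gap0 ^ 4 + real (n_constr P i) *
   (8 * \<beta> * gap0 ^ 4 / barrier_rate + 16 * (\<beta>\<^sub>1 + \<beta>)\<^sup>2 * gap0 ^ 3 / barrier_rate\<^sup>2)"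
  have "L i / 2 + \<rho> \<epsilon> * (real (n_constr P i) * (\<beta> / (2 * \<delta>\<^sup>2) + 2 * (\<beta>\<^sub>1 + \<beta>)\<^sup>2 / \<delta> ^ 3))
      = L i / 2 + real (n_constr P i) * (\<rho> \<epsilon> * (\<beta> / (2 * \<delta>\<^sup>2)) + \<rho> \<epsilon> * (2 * (\<beta>\<^sub>1 + \<beta>)\<^sup>2 / \<delta> ^ 3))"
    by (simp add: algebra_simps)
  also have "\<dots> \<le> 8 * L i * gap0 ^ 4 / \<epsilon> ^ 4 + real (n_constr P i) * ((8 * \<beta> * gap0 ^ 4 / barrier_rate) / \<epsilon> ^ 4
      + (16 * (\<beta>\<^sub>1 + \<beta>)\<^sup>2 * gap0 ^ 3 / barrier_rate\<^sup>2) / \<epsilon> ^ 4)"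
    using 1 2 3 by (intro add_mono mult_left_mono) auto
  also have "\<dots> = ?c i / \<epsilon> ^ 4" by (simp add: add_divide_distrib distrib_left)
  also have "\<dots> \<le> curvature / \<epsilon> ^ 4"
  proof -
    have "0 \<le> ?c l" for l using L_pos[of l] pos by (intro add_nonneg_nonneg mult_nonneg_nonneg divide_nonneg_nonneg) auto
    thus ?thesis unfolding curvature_def using pos by (intro divide_right_mono member_le_sum) auto
  qed
  finally show ?thesis .
qed

text \<open>
  The three earlier bounds meet here: the depth \<open>\<delta> = \<rho> / (2 gap0)\<close> of the iterates, the curvature at this depth, and the
  norm-controlled splitting of \<open>z - x\<close>.  Convexity turns the first-order term into the gap \<open>F x - F z\<close>.
\<close>

lemma uniform_progress:
  obtains A b where "0 < A" "0 < b"
    and "progress_bound A b"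
proof -
  obtain \<kappa> where \<kappa>: "0 < \<kappa>"
    "\<And>w. coeff P *v w = 0 \<Longrightarrow> \<exists>u. (\<forall>j. u j \<in> reach_space P j) \<and> w = (\<Sum>j\<in>UNIV. u j)
           \<and> (\<forall>j. norm (u j) \<le> \<kappa> * weight P j * norm w)"
    using null_decomposition by blast
  \<comment> \<open>\<open>r \<epsilon>\<^sup>2\<close> is the safe radius: at most \<open>1\<close>, and at most \<open>\<delta> / (2 (\<beta>\<^sub>1 + \<beta>))\<close> for \<open>\<delta> = \<rho> / (2 gap0)\<close>\<close>
  define r where "r = min (1 / (4 * gap0\<^sup>2)) (barrier_rate / (4 * gap0 * (\<beta>\<^sub>1 + \<beta> + 1)))"
  note pos = gap0_pos barrier_rate_pos \<beta>s_nonneg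
  have r: "0 < r" using pos by (simp add: r_def)
  show thesis
  proof (rule that[of "curvature * real CARD('v) * \<kappa>\<^sup>2" "r / \<kappa>"])
    show "0 < curvature * real CARD('v) * \<kappa>\<^sup>2" using curvature_pos \<kappa> by simp
    show "0 < r / \<kappa>" using r \<kappa> by simp
    show "progress_bound (curvature * real CARD('v) * \<kappa>\<^sup>2) (r / \<kappa>)"
      unfolding progress_bound_def
    proof (intro allI impI)
      fix \<epsilon> x x' z \<sigma> s
      assume \<epsilon>: "\<epsilon> \<in> eps_range P x0" and tl: "tangent_lower \<sigma>" and x: "x \<in> bar_feasible P" "F \<epsilon> x \<le> F \<epsilon> x0"
        and step: "dfm_update (\<rho> \<epsilon>) x x'" and z: "z \<in> bar_feasible P"
        and s: "0 \<le> s" "s * norm (z - x) \<le> r / \<kappa> * \<epsilon>\<^sup>2"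
      note e = eps_rangeD[OF \<epsilon>]
      note \<rho> = less_imp_le[OF barrier_param_pos[OF \<epsilon>]]
      have "coeff P *v (z - x) = 0"
        using x z by (simp add: bar_feasible_def matrix_vector_mult_diff_distrib)
      then obtain u where u: "\<forall>j. u j \<in> reach_space P j" "z - x = (\<Sum>j\<in>UNIV. u j)"
        "\<forall>j. norm (u j) \<le> \<kappa> * weight P j * norm (z - x)"
        using \<kappa>(2) by blast
      have e2: "\<epsilon>\<^sup>2 \<le> 4 * gap0\<^sup>2"
        using power_mono[of \<epsilon> "2 * gap0" 2] e by (simp add: power_mult_distrib)
      have r1: "r * \<epsilon>\<^sup>2 \<le> 1"
      proof -
        have "r * \<epsilon>\<^sup>2 \<le> 1 / (4 * gap0\<^sup>2) * (4 * gap0\<^sup>2)"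
          using e2 r pos by (intro mult_mono) (auto simp: r_def)
        thus ?thesis using pos by simp
      qed
      have r2: "(\<beta>\<^sub>1 + \<beta>) * (r * \<epsilon>\<^sup>2) \<le> (\<rho> \<epsilon> / (2 * gap0)) / 2"
      proof -
        have "(\<beta>\<^sub>1 + \<beta>) * r \<le> (\<beta>\<^sub>1 + \<beta> + 1) * (barrier_rate / (4 * gap0 * (\<beta>\<^sub>1 + \<beta> + 1)))"
          using r pos by (intro mult_mono) (auto simp: r_def)
        also have "\<dots> = barrier_rate / (4 * gap0)" using pos by (simp add: divide_simps)
        finally have "(\<beta>\<^sub>1 + \<beta>) * r * \<epsilon>\<^sup>2 \<le> barrier_rate / (4 * gap0) * \<epsilon>\<^sup>2" by (rule mult_right_mono) simp
        thus ?thesis by (simp add: barrier_param_alt mult_ac)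
      qed
      have s2: "s * (\<kappa> * norm (z - x)) \<le> r * \<epsilon>\<^sup>2" using s \<kappa>(1) by (simp add: field_simps)
      have "F \<epsilon> x' \<le> F \<epsilon> x + s * (bar_grad (\<rho> \<epsilon>) x \<bullet> (\<Sum>j\<in>UNIV. u j))
             + curvature / \<epsilon> ^ 4 * real CARD('v) * (s * (\<kappa> * norm (z - x)))\<^sup>2"
      proof (rule dfm_update_decrease[OF x(1) \<rho> step, where \<delta> = "\<rho> \<epsilon> / (2 * gap0)" and r = "r * \<epsilon>\<^sup>2"])
        show "0 < \<rho> \<epsilon> / (2 * gap0)" using barrier_param_pos[OF \<epsilon>] gap0_pos by simp
        show "0 \<le> curvature / \<epsilon> ^ 4" using curvature_pos e by simp
      qed (use u s s2 r1 r2 \<beta>s_nonneg curvature_bound[OF \<epsilon> refl] constr_bounded_away[OF \<epsilon> x] in auto)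
      moreover have "s * (bar_grad (\<rho> \<epsilon>) x \<bullet> (z - x)) \<le> s * (F \<epsilon> z - F \<epsilon> x - \<sigma> / 2 * (norm (z - x))\<^sup>2)"
        using bar_objective_above_tangent[OF tl \<rho> x(1) z] s by (intro mult_left_mono) auto
      moreover have "curvature / \<epsilon> ^ 4 * real CARD('v) * (s * (\<kappa> * norm (z - x)))\<^sup>2
          = curvature * real CARD('v) * \<kappa>\<^sup>2 / \<epsilon> ^ 4 * (s * norm (z - x))\<^sup>2"
        by (simp add: power_mult_distrib)
      ultimately show "F \<epsilon> x' \<le> F \<epsilon> x - s * (F \<epsilon> x - F \<epsilon> z + \<sigma> / 2 * (norm (z - x))\<^sup>2)
                      + curvature * real CARD('v) * \<kappa>\<^sup>2 / \<epsilon> ^ 4 * (s * norm (z - x))\<^sup>2"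
        unfolding u(2)[symmetric] by (simp add: algebra_simps)
    qed
  qed
qed

end

end

section \<open>Bounded sublevel sets and the point of comparison\<close>

context barrier_dfm begin

text \<open>
  The sublevel sets of \<open>F\<close> vary with \<open>\<rho>\<close>, but compactness for a single value \<open>r\<close> bounds all the sublevel sets of the
  objective at once.  If one of these were unbounded, it would contain a ray from \<open>x0\<close>.  Along this ray the
  objective and all constraint functions are bounded above, so they never exceed their values at \<open>x0\<close>; the same
  then holds for the barrier, and the ray would lie in the compact set.
\<close>

lemma bounded_objective_sublevel:
  assumes conv: "\<And>i. convex_on (E i) (loc_obj P i)" and \<rho>: "0 \<le> r"
    and comp: "compact {z \<in> bar_feasible P. bar_objective P r z \<le> bar_objective P r x0}"
    and M: "objective P x0 \<le> M"
  shows "bounded {x \<in> feasible P. objective P x \<le> M}" (is "bounded ?D")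
proof (rule ccontr)
  assume unb: "\<not> bounded ?D"
  have D: "?D = feasible P \<inter> {x. objective P x \<le> M}" by auto
  have clo: "closed {x. objective P x \<le> M}"
    by (intro closed_Collect_le continuous_on_objective continuous_on_const)
  have cvx: "convex {x. objective P x \<le> M}"
  proof (rule convexI)
    fix x y and u v :: real
    assume xy: "x \<in> {x. objective P x \<le> M}" "y \<in> {x. objective P x \<le> M}" and uv: "0 \<le> u" "0 \<le> v" "u + v = 1"
    have "objective P (u *\<^sub>R x + v *\<^sub>R y) \<le> u * objective P x + v * objective P y"
      using objective_convex[OF conv] uv by (simp add: convex_on_def)
    also have "\<dots> \<le> M" using xy uv by (intro convex_bound_le) auto
    finally show "u *\<^sub>R x + v *\<^sub>R y \<in> {x. objective P x \<le> M}" by simp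
  qed
  have "closed ?D" unfolding D by (intro closed_Int closed_feasible clo)
  moreover have "convex ?D" unfolding D by (intro convex_Int convex_feasible cvx)
  moreover have "x0 \<in> ?D" using M x0 bar_feasible_feasible by simp
  moreover note unb
  ultimately obtain d where d: "norm d = 1" "\<And>t. 0 \<le> t \<Longrightarrow> x0 + t *\<^sub>R d \<in> ?D"
    by (rule closed_convex_unbounded_ray) (rule that)
  have mem: "x0 + t *\<^sub>R d \<in> {z \<in> bar_feasible P. bar_objective P r z \<le> bar_objective P r x0}" if t: "0 \<le> t" for t
  proof -
    have le: "constr P i j (block P i (x0 + t *\<^sub>R d)) \<le> constr P i j (block P i x0)"
      if j: "j \<in> {1..n_constr P i}" for i j
    proof -
      have "constr P i j (block P i x0 + t *\<^sub>R block P i d) \<le> constr P i j (block P i x0)"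
      proof (rule convex_bounded_above_on_ray[OF constr_convex[OF j] _ _ t])
        fix s :: real assume "0 \<le> s"
        hence "x0 + s *\<^sub>R d \<in> feasible P" using d(2) by blast
        hence "constr P i j (block P i (x0 + s *\<^sub>R d)) \<le> 0" using j by (simp add: feasible_def loc_set_def)
        thus "constr P i j (block P i x0 + s *\<^sub>R block P i d) \<le> 0" by (simp add: block_simps)
      qed (simp add: block_simps[symmetric])
      thus ?thesis by (simp add: block_simps)
    qed
    have neg: "constr P i j (block P i x0) < 0" if "j \<in> {1..n_constr P i}" for i j
      using bar_feasible_block[OF x0, of i] that by (simp add: loc_set_strict_def)
    have "x0 + t *\<^sub>R d \<in> feasible P" using d(2)[OF t] by blast
    moreover have "constr P i j (block P i (x0 + t *\<^sub>R d)) < 0" if "j \<in> {1..n_constr P i}" for i j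
      using le[OF that] neg[OF that] by simp
    ultimately have bf: "x0 + t *\<^sub>R d \<in> bar_feasible P"
      by (simp add: bar_feasible_def feasible_def loc_set_strict_def coeff_sum_blocks)
    have "barrier P (x0 + t *\<^sub>R d) \<le> barrier P x0"
      unfolding barrier_def loc_barrier_def
    proof (intro sum_mono le_imp_neg_le)
      fix i j assume j: "j \<in> {1..n_constr P i}"
      show "1 / constr P i j (block P i x0) \<le> 1 / constr P i j (block P i (x0 + t *\<^sub>R d))"
        using le_imp_inverse_le_neg[OF le[OF j] neg[OF j]] by (simp add: inverse_eq_divide)
    qed
    moreover have "objective P (x0 + t *\<^sub>R d) \<le> objective P x0"
      using d(2) t by (intro convex_bounded_above_on_ray[OF objective_convex[OF conv]]) auto
    ultimately have "bar_objective P r (x0 + t *\<^sub>R d) \<le> bar_objective P r x0"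
      unfolding bar_objective_def using \<rho> by (intro add_mono mult_left_mono)
    thus ?thesis using bf by simp
  qed
  obtain B where B: "\<And>z. z \<in> {z \<in> bar_feasible P. bar_objective P r z \<le> bar_objective P r x0} \<Longrightarrow> norm z \<le> B"
    using compact_imp_bounded[OF comp] unfolding bounded_iff by blast
  define t where "t = norm x0 + \<bar>B\<bar> + 1"
  have "t = norm (t *\<^sub>R d)" using d(1) by (simp add: t_def)
  also have "\<dots> \<le> norm (x0 + t *\<^sub>R d) + norm x0" using norm_triangle_ineq4[of "x0 + t *\<^sub>R d" x0] by simp
  also have "\<dots> \<le> B + norm x0" using B[OF mem[of t]] by (simp add: t_def)
  finally show False by (simp add: t_def)
qed

context
  assumes gap0_pos: "0 < gap0"
begin

text \<open>
  Compare with the midpoint \<open>m\<close>, where the objective is at least its optimal value.  The two tangent inequalities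
  at \<open>m\<close> have opposite linear terms.
\<close>

lemma diameter_strongly_convex:
  assumes tl: "tangent_lower \<sigma>" and \<sigma>: "0 < \<sigma>"
    and y: "y \<in> bar_feasible P" "objective P y \<le> opt_value P + 3 * gap0"
    and z: "z \<in> bar_feasible P" "objective P z \<le> opt_value P + 3 * gap0"
  shows "norm (z - y) \<le> sqrt (24 * gap0 / \<sigma>)"
proof -
  define m where "m = (1 / 2) *\<^sub>R y + (1 / 2) *\<^sub>R z"
  have m: "m \<in> bar_feasible P"
    unfolding m_def using y z by (intro convexD[OF convex_bar_feasible]) auto
  have my: "y - m = - ((1 / 2) *\<^sub>R (z - y))" and mz: "z - m = (1 / 2) *\<^sub>R (z - y)"
    by (simp_all add: m_def algebra_simps scaleR_left_distrib[symmetric])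
  note tan = bar_objective_above_tangent[OF tl, of 0 m, folded objective_alt, OF order_refl m]
  have "\<sigma> / 4 * (norm (z - y))\<^sup>2 \<le> objective P y + objective P z - 2 * objective P m"
    using tan[OF y(1)] tan[OF z(1)] unfolding my mz by (simp add: power2_eq_square)
  also have "\<dots> \<le> 6 * gap0"
    using y z opt_value_le[OF bar_feasible_feasible[OF m]] by linarith
  finally have "(norm (z - y))\<^sup>2 \<le> 24 * gap0 / \<sigma>" using \<sigma> by (simp add: field_simps)
  thus ?thesis by (rule real_le_rsqrt)
qed

text \<open>
  Moving from a near-optimal \<open>y\<close> by the fraction \<open>t\<close> towards \<open>x0\<close> makes every constraint at most \<open>t\<close> times its value
  at \<open>x0\<close>, so the barrier is at most \<open>B(x0) / t\<close>, while the objective grows by at most \<open>t\<close> times the initial gap.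
  The fraction \<open>\<epsilon> / (2 gap0)\<close> makes both contributions at most \<open>\<epsilon> / 2\<close>.
\<close>

lemma reference_point:
  assumes conv: "\<And>i. convex_on (E i) (loc_obj P i)" and \<epsilon>: "\<epsilon> \<in> eps_range P x0"
  obtains z where "z \<in> bar_feasible P" "F \<epsilon> z \<le> opt_value P + 5 / 4 * \<epsilon>"
proof -
  note e = eps_rangeD[OF gap0_pos \<epsilon>]
  note \<rho> = barrier_param_pos[OF gap0_pos \<epsilon>]
  have "opt_value P < opt_value P + \<epsilon> / 4" using e by simp
  then obtain y where y: "y \<in> feasible P" "objective P y < opt_value P + \<epsilon> / 4"
    using assumption1 x0 bar_feasible_feasible unfolding opt_value_def assumption1_def
    by (subst (asm) cINF_less_iff) auto
  define t where "t = \<epsilon> / (2 * gap0)"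
  have t: "0 < t" "t < 1" using e gap0_pos by (auto simp: t_def)
  define z where "z = (1 - t) *\<^sub>R y + t *\<^sub>R x0"
  have neg: "constr P i j (block P i x0) < 0" if "j \<in> {1..n_constr P i}" for i j
    using bar_feasible_block[OF x0, of i] that by (simp add: loc_set_strict_def)
  have g: "constr P i j (block P i z) \<le> t * constr P i j (block P i x0)" if j: "j \<in> {1..n_constr P i}" for i j
  proof -
    have "constr P i j (block P i z) \<le> (1 - t) * constr P i j (block P i y) + t * constr P i j (block P i x0)"
      using convex_onD[OF constr_convex[OF j], of t] t by (simp add: z_def block_simps)
    moreover have "(1 - t) * constr P i j (block P i y) \<le> 0"
      using y(1) j t by (intro mult_nonneg_nonpos) (auto simp: feasible_def loc_set_def)
    ultimately show ?thesis by linarith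
  qed
  have tneg: "t * constr P i j (block P i x0) < 0" if "j \<in> {1..n_constr P i}" for i j
    using t neg[OF that] by (simp add: mult_pos_neg)
  have "coeff P *v z = (1 - t) *\<^sub>R rhs P + t *\<^sub>R rhs P"
    using y(1) x0 by (simp add: z_def matrix_vector_right_distrib matrix_vector_mult_scaleR
        feasible_def bar_feasible_def coeff_sum_blocks)
  hence "coeff P *v z = rhs P" by (simp add: scaleR_left_distrib[symmetric])
  moreover have "constr P i j (block P i z) < 0" if "j \<in> {1..n_constr P i}" for i j
    using g[OF that] tneg[OF that] by linarith
  ultimately have bf: "z \<in> bar_feasible P" by (simp add: bar_feasible_def loc_set_strict_def)
  have "barrier P z \<le> (\<Sum>i\<in>UNIV. - (\<Sum>j = 1..n_constr P i. 1 / (t * constr P i j (block P i x0))))"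
    unfolding barrier_def loc_barrier_def
  proof (intro sum_mono le_imp_neg_le)
    fix i j assume j: "j \<in> {1..n_constr P i}"
    show "1 / (t * constr P i j (block P i x0)) \<le> 1 / constr P i j (block P i z)"
      using le_imp_inverse_le_neg[OF g[OF j] tneg[OF j]] by (simp add: inverse_eq_divide)
  qed
  also have "\<dots> = barrier P x0 / t"
    unfolding barrier_def loc_barrier_def by (simp add: sum_divide_distrib sum_negf mult.commute)
  finally have "\<rho> \<epsilon> * barrier P z \<le> \<rho> \<epsilon> * (barrier P x0 / t)" using \<rho> by (intro mult_left_mono) auto
  also have "\<dots> \<le> (\<epsilon>\<^sup>2 / (4 * gap0)) / t"
    using divide_right_mono[OF barrier_param_x0[OF gap0_pos, of \<epsilon>], of t] t by simp
  also have "\<dots> = \<epsilon> / 2" using e gap0_pos by (simp add: t_def power2_eq_square)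
  finally have 1: "\<rho> \<epsilon> * barrier P z \<le> \<epsilon> / 2" .
  have "objective P z \<le> (1 - t) * objective P y + t * objective P x0"
    using convex_onD[OF objective_convex[OF conv], of t] t by (simp add: z_def)
  also have "\<dots> \<le> (1 - t) * (opt_value P + \<epsilon> / 4) + t * objective P x0"
    using y t by (intro add_right_mono mult_left_mono) auto
  also have "\<dots> = opt_value P + (1 - t) * (\<epsilon> / 4) + t * gap0"
    by (simp add: gap0_def algebra_simps)
  also have "\<dots> \<le> opt_value P + \<epsilon> / 4 + \<epsilon> / 2"
    using t e gap0_pos by (simp add: t_def[symmetric]) (simp add: t_def)
  finally have "F \<epsilon> z \<le> opt_value P + 5 / 4 * \<epsilon>" using 1 by (simp add: bar_objective_def)
  with bf show thesis by (rule that)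
qed

end

end

section \<open>Iteration counts\<close>

context barrier_dfm begin

context
  assumes gap0_pos: "0 < gap0"
begin

lemma dfm_run_invariant:
  assumes tl: "tangent_lower 0" and \<epsilon>: "\<epsilon> \<in> eps_range P x0" and run: "dfm_run P L (\<rho> \<epsilon>) x0 x"
  shows "x k \<in> bar_feasible P \<and> F \<epsilon> (x k) \<le> F \<epsilon> x0"
proof -
  obtain A b where Ab: "0 < A" "0 < b" and progress: "progress_bound A b"
    by (rule uniform_progress[OF gap0_pos]) (rule that)
  have init: "x 0 = x0" and step: "\<And>k. dfm_update (\<rho> \<epsilon>) (x k) (x (Suc k))"
    using run by (auto simp: dfm_run_iff)
  show ?thesis
  proof (induction k)
    case 0
    thus ?case using init x0 by simp
  next
    case (Suc k)
    have "F \<epsilon> (x (Suc k)) \<le> F \<epsilon> (x k)"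
      using progress[unfolded progress_bound_def, rule_format, OF \<epsilon> tl _ _ step, of k x0 0] Suc x0 Ab(2) by simp
    thus ?case
      using Suc dfm_update_feasible[OF _ _ step] barrier_param_pos[OF gap0_pos \<epsilon>]
      by (meson less_imp_le order_trans)
  qed
qed

lemma eps_optimalI:
  assumes \<epsilon>: "\<epsilon> \<in> eps_range P x0" and y: "y \<in> bar_feasible P"
    and z: "F \<epsilon> z \<le> opt_value P + 5 / 4 * \<epsilon>" and yz: "F \<epsilon> y - F \<epsilon> z \<le> 3 / 4 * \<epsilon>"
  shows "eps_optimal P \<epsilon> y"
  using objective_le_F[OF gap0_pos \<epsilon> y] z yz by (simp add: eps_optimal_def)

lemma eps_pow4_le:
  assumes "\<epsilon> \<in> eps_range P x0"
  shows "\<epsilon> ^ 4 \<le> 4 * gap0\<^sup>2 * \<epsilon>\<^sup>2"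
proof -
  have "\<epsilon>\<^sup>2 \<le> 4 * gap0\<^sup>2"
    using power_mono[of \<epsilon> "2 * gap0" 2] eps_rangeD[OF gap0_pos assms] by (simp add: power_mult_distrib)
  from mult_right_mono[OF this, of "\<epsilon>\<^sup>2"] show ?thesis by (simp add: eval_nat_numeral mult.assoc)
qed

text \<open>
  With \<open>s = c \<epsilon>\<^sup>4\<close> for small \<open>c\<close>, strong convexity absorbs the second-order term, so the gap to the reference point
  contracts by the factor \<open>1 - s \<le> exp (- s)\<close>.  It starts at \<open>2 gap0\<close> or less and has to reach \<open>3/4 \<epsilon>\<close>.
\<close>

lemma linear_rate:
  assumes \<sigma>: "0 < \<sigma>" and tl: "tangent_lower \<sigma>" and tl0: "tangent_lower 0"
    and conv: "\<And>i. convex_on (E i) (loc_obj P i)"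
  obtains C where "0 < C"
    and "\<And>\<epsilon> x. \<epsilon> \<in> eps_range P x0 \<Longrightarrow> dfm_run P L (\<rho> \<epsilon>) x0 x \<Longrightarrow>
      \<exists>k. eps_optimal P \<epsilon> (x k) \<and> real k \<le> C / \<epsilon> ^ 4 * ln (8 * gap0 / (3 * \<epsilon>)) + 1"
proof -
  obtain A b where Ab: "0 < A" "0 < b" and progress: "progress_bound A b"
    by (rule uniform_progress[OF gap0_pos]) (rule that)
  define R where "R = sqrt (24 * gap0 / \<sigma>)"
  have R: "0 < R" using gap0_pos \<sigma> by (simp add: R_def)
  \<comment> \<open>the three terms give \<open>s \<le> 1\<close>, absorb the second-order term and keep the competitors in the safe radius\<close>
  define c where "c = min (1 / (16 * gap0 ^ 4)) (min (\<sigma> / (2 * A)) (b / (4 * gap0\<^sup>2 * R)))"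
  have c: "0 < c" "c \<le> 1 / (16 * gap0 ^ 4)" "c \<le> \<sigma> / (2 * A)" "c \<le> b / (4 * gap0\<^sup>2 * R)"
    using gap0_pos \<sigma> Ab R by (simp_all add: c_def)
  have cA: "A * c \<le> \<sigma> / 2" using c(3) Ab by (simp add: field_simps)
  have cb: "c * (4 * gap0\<^sup>2 * R) \<le> b" using c(4) gap0_pos R by (simp add: pos_le_divide_eq)
  show thesis
  proof (rule that[of "1 / c"])
    show "0 < 1 / c" using c by simp
  next
    fix \<epsilon> x assume \<epsilon>: "\<epsilon> \<in> eps_range P x0" and run: "dfm_run P L (\<rho> \<epsilon>) x0 x"
    note e = eps_rangeD[OF gap0_pos \<epsilon>]
    note inv = dfm_run_invariant[OF tl0 \<epsilon> run]
    have init: "x 0 = x0" and step: "\<And>k. dfm_update (\<rho> \<epsilon>) (x k) (x (Suc k))"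
      using run by (auto simp: dfm_run_iff)
    obtain z where z: "z \<in> bar_feasible P" "F \<epsilon> z \<le> opt_value P + 5 / 4 * \<epsilon>"
      using reference_point[OF gap0_pos conv \<epsilon>] by blast
    have z3: "objective P z \<le> opt_value P + 3 * gap0"
      using objective_le_F[OF gap0_pos \<epsilon> z(1)] z(2) e gap0_pos by linarith
    define s where "s = c * \<epsilon> ^ 4"
    have s0: "0 < s" using c e by (simp add: s_def)
    have s1: "s \<le> 1"
    proof -
      have "\<epsilon> ^ 4 \<le> 16 * gap0 ^ 4"
        using power_mono[of \<epsilon> "2 * gap0" 4] e by (simp add: power_mult_distrib)
      hence "s \<le> 1 / (16 * gap0 ^ 4) * (16 * gap0 ^ 4)"
        unfolding s_def using c e by (intro mult_mono) auto
      thus ?thesis using gap0_pos by simp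
    qed
    define G where "G k = F \<epsilon> (x k) - F \<epsilon> z" for k
    have rec: "G (Suc k) \<le> (1 - s) * G k" for k
    proof -
      have x3: "objective P (x k) \<le> opt_value P + 3 * gap0"
        using objective_le_F[OF gap0_pos \<epsilon>, of "x k"] inv[of k] F_x0_le[OF gap0_pos \<epsilon>] gap0_pos by linarith
      let ?n = "norm (z - x k)"
      have n: "?n \<le> R"
        unfolding R_def using diameter_strongly_convex[OF gap0_pos tl \<sigma> _ x3 z(1) z3] inv[of k] by simp
      have "s * ?n \<le> s * R" using n s0 by (intro mult_left_mono) auto
      also have "\<dots> \<le> c * (4 * gap0\<^sup>2 * \<epsilon>\<^sup>2) * R"
        unfolding s_def using eps_pow4_le[OF \<epsilon>] c R by (intro mult_right_mono mult_left_mono) auto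
      also have "\<dots> \<le> b * \<epsilon>\<^sup>2" using mult_right_mono[OF cb, of "\<epsilon>\<^sup>2"] by (simp add: mult_ac)
      finally have sn: "s * ?n \<le> b * \<epsilon>\<^sup>2" .
      have "A / \<epsilon> ^ 4 * (s * ?n)\<^sup>2 = (A * c) * (s * ?n\<^sup>2)"
        using e by (simp add: s_def power_mult_distrib power2_eq_square)
      also have "\<dots> \<le> (\<sigma> / 2) * (s * ?n\<^sup>2)" using cA s0 by (intro mult_right_mono) auto
      finally have "A / \<epsilon> ^ 4 * (s * ?n)\<^sup>2 \<le> s * (\<sigma> / 2 * ?n\<^sup>2)" by (simp add: mult_ac)
      moreover have "F \<epsilon> (x (Suc k)) \<le> F \<epsilon> (x k) - s * (G k + \<sigma> / 2 * ?n\<^sup>2) + A / \<epsilon> ^ 4 * (s * ?n)\<^sup>2"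
        using progress[unfolded progress_bound_def, rule_format, OF \<epsilon> tl _ _ step z(1) _ sn] inv[of k] s0 by (simp add: G_def)
      ultimately have "F \<epsilon> (x (Suc k)) \<le> F \<epsilon> (x k) - s * G k" unfolding distrib_left by linarith
      thus ?thesis by (simp add: G_def algebra_simps)
    qed
    have G0: "G 0 \<le> 2 * gap0"
      using F_x0_le[OF gap0_pos \<epsilon>] objective_le_F[OF gap0_pos \<epsilon> z(1)]
        opt_value_le[OF bar_feasible_feasible[OF z(1)]] by (simp add: G_def init)
    have Gk: "G k \<le> (1 - s) ^ k * (2 * gap0)" for k
    proof (induction k)
      case (Suc k)
      have "(1 - s) * G k \<le> (1 - s) * ((1 - s) ^ k * (2 * gap0))"
        using Suc s1 by (intro mult_left_mono) auto
      thus ?case using rec[of k] by (simp add: mult_ac)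
    qed (use G0 in simp)
    define l where "l = ln (8 * gap0 / (3 * \<epsilon>))"
    have l: "0 < l" unfolding l_def using e gap0_pos by (intro ln_gt_zero) (simp add: field_simps)
    define k where "k = nat \<lceil>l / s\<rceil>"
    have k: "l / s \<le> real k" "real k \<le> l / s + 1" using l s0 by (simp_all add: k_def)
    have "(1 - s) ^ k \<le> exp (- s) ^ k"
      using s1 exp_ge_add_one_self[of "- s"] by (intro power_mono) auto
    also have "\<dots> = exp (- (s * real k))" by (simp add: exp_of_nat_mult[symmetric] mult.commute)
    also have "\<dots> \<le> exp (- l)" using k(1) s0 by (simp add: field_simps)
    also have "\<dots> = 3 * \<epsilon> / (8 * gap0)" using e gap0_pos by (simp add: l_def exp_minus)
    finally have "(1 - s) ^ k * (2 * gap0) \<le> 3 * \<epsilon> / (8 * gap0) * (2 * gap0)"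
      using gap0_pos by (intro mult_right_mono) auto
    also have "\<dots> = 3 / 4 * \<epsilon>" using gap0_pos by simp
    finally have "G k \<le> 3 / 4 * \<epsilon>" using Gk[of k] by linarith
    hence "eps_optimal P \<epsilon> (x k)"
      using eps_optimalI[OF \<epsilon> _ z(2)] inv[of k] by (simp add: G_def)
    thus "\<exists>k. eps_optimal P \<epsilon> (x k) \<and> real k \<le> 1 / c / \<epsilon> ^ 4 * ln (8 * gap0 / (3 * \<epsilon>)) + 1"
      using k(2) by (intro exI[of _ k]) (simp add: s_def l_def)
  qed
qed

text \<open>
  Without strong convexity, the best \<open>s\<close> is proportional to the current gap: \<open>s = c \<epsilon>\<^sup>4 G\<^sub>k\<close>.  Half of the first-order
  decrease \<open>s G\<^sub>k\<close> then pays for the second-order term.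
\<close>

lemma sublinear_rate:
  assumes tl0: "tangent_lower 0" and conv: "\<And>i. convex_on (E i) (loc_obj P i)"
    and bdd: "bounded {x \<in> feasible P. objective P x \<le> opt_value P + 3 * gap0}"
  obtains C where "0 < C"
    and "\<And>\<epsilon> x. \<epsilon> \<in> eps_range P x0 \<Longrightarrow> dfm_run P L (\<rho> \<epsilon>) x0 x \<Longrightarrow>
      \<exists>k. eps_optimal P \<epsilon> (x k) \<and> real k \<le> C / \<epsilon> ^ 5 + 1"
proof -
  obtain A b where Ab: "0 < A" "0 < b" and progress: "progress_bound A b"
    by (rule uniform_progress[OF gap0_pos]) (rule that)
  obtain B where B: "0 < B" "\<And>x. x \<in> {x \<in> feasible P. objective P x \<le> opt_value P + 3 * gap0} \<Longrightarrow> norm x \<le> B"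
    using bdd unfolding bounded_pos by blast
  define R where "R = 2 * B"
  have R: "0 < R" using B by (simp add: R_def)
  \<comment> \<open>the first term pays for the second-order term, the second keeps the competitors in the safe radius\<close>
  define c where "c = min (1 / (2 * A * R\<^sup>2)) (b / (8 * gap0 ^ 3 * R))"
  have c: "0 < c" "c \<le> 1 / (2 * A * R\<^sup>2)" "c \<le> b / (8 * gap0 ^ 3 * R)"
    using gap0_pos Ab R by (simp_all add: c_def)
  have cA: "A * c * R\<^sup>2 \<le> 1 / 2" using c(2) Ab R by (simp add: field_simps)
  have cb: "c * (8 * gap0 ^ 3 * R) \<le> b" using c(3) gap0_pos R by (simp add: pos_le_divide_eq)
  show thesis
  proof (rule that[of "8 / (3 * c)"])
    show "0 < 8 / (3 * c)" using c by simp
  next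
    fix \<epsilon> x assume \<epsilon>: "\<epsilon> \<in> eps_range P x0" and run: "dfm_run P L (\<rho> \<epsilon>) x0 x"
    note e = eps_rangeD[OF gap0_pos \<epsilon>]
    note inv = dfm_run_invariant[OF tl0 \<epsilon> run]
    have init: "x 0 = x0" and step: "\<And>k. dfm_update (\<rho> \<epsilon>) (x k) (x (Suc k))"
      using run by (auto simp: dfm_run_iff)
    obtain z where z: "z \<in> bar_feasible P" "F \<epsilon> z \<le> opt_value P + 5 / 4 * \<epsilon>"
      using reference_point[OF gap0_pos conv \<epsilon>] by blast
    have z3: "objective P z \<le> opt_value P + 3 * gap0"
      using objective_le_F[OF gap0_pos \<epsilon> z(1)] z(2) e gap0_pos by linarith
    define G where "G k = F \<epsilon> (x k) - F \<epsilon> z" for k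
    define a where "a = c / 2 * \<epsilon> ^ 4"
    have a: "0 < a" using c e by (simp add: a_def)
    have rec: "G (Suc k) \<le> G k - a * (G k)\<^sup>2" if G: "0 < G k" for k
    proof -
      have "objective P (x k) \<le> opt_value P + 3 * gap0"
        using objective_le_F[OF gap0_pos \<epsilon>, of "x k"] inv[of k] F_x0_le[OF gap0_pos \<epsilon>] gap0_pos by linarith
      hence "norm (x k) \<le> B" "norm z \<le> B"
        using inv[of k] z z3 by (auto intro!: B(2) bar_feasible_feasible)
      let ?n = "norm (z - x k)"
      have n: "?n \<le> R" using norm_triangle_ineq4[of z "x k"] \<open>norm (x k) \<le> B\<close> \<open>norm z \<le> B\<close>
        by (simp add: R_def)
      have G2: "G k \<le> 2 * gap0"
        using inv[of k] F_x0_le[OF gap0_pos \<epsilon>] objective_le_F[OF gap0_pos \<epsilon> z(1)]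
          opt_value_le[OF bar_feasible_feasible[OF z(1)]] by (simp add: G_def)
      define s where "s = c * \<epsilon> ^ 4 * G k"
      have s0: "0 < s" using c e G by (simp add: s_def)
      have "s * ?n \<le> s * R" using n s0 by (intro mult_left_mono) auto
      also have "\<dots> \<le> (c * (4 * gap0\<^sup>2 * \<epsilon>\<^sup>2) * (2 * gap0)) * R"
        unfolding s_def using eps_pow4_le[OF \<epsilon>] G2 G c R e gap0_pos
        by (intro mult_right_mono mult_mono) auto
      also have "\<dots> \<le> b * \<epsilon>\<^sup>2"
        using mult_right_mono[OF cb, of "\<epsilon>\<^sup>2"] by (simp add: mult_ac eval_nat_numeral)
      finally have sn: "s * ?n \<le> b * \<epsilon>\<^sup>2" .
      have "A / \<epsilon> ^ 4 * (s * ?n)\<^sup>2 \<le> A / \<epsilon> ^ 4 * (s * R)\<^sup>2"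
        using n s0 Ab e by (intro mult_left_mono power_mono) auto
      also have "\<dots> = (A * c * R\<^sup>2) * (c * \<epsilon> ^ 4 * (G k)\<^sup>2)"
        using e by (simp add: s_def power_mult_distrib power2_eq_square)
      also have "\<dots> \<le> 1 / 2 * (c * \<epsilon> ^ 4 * (G k)\<^sup>2)" using cA c e by (intro mult_right_mono) auto
      also have "\<dots> = a * (G k)\<^sup>2" by (simp add: a_def)
      finally have "A / \<epsilon> ^ 4 * (s * ?n)\<^sup>2 \<le> a * (G k)\<^sup>2" .
      moreover have "F \<epsilon> (x (Suc k)) \<le> F \<epsilon> (x k) - s * G k + A / \<epsilon> ^ 4 * (s * ?n)\<^sup>2"
        using progress[unfolded progress_bound_def, rule_format, OF \<epsilon> tl0 _ _ step z(1) _ sn] inv[of k] s0 by (simp add: G_def)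
      moreover have "s * G k = 2 * (a * (G k)\<^sup>2)" by (simp add: s_def a_def power2_eq_square)
      ultimately show ?thesis unfolding G_def by linarith
    qed
    define n where "n = nat \<lceil>4 / (3 * \<epsilon> * a)\<rceil>"
    have n: "4 / (3 * \<epsilon> * a) \<le> real n" "real n \<le> 4 / (3 * \<epsilon> * a) + 1"
      using e a by (simp_all add: n_def)
    have "\<exists>k\<le>n. G k \<le> 3 / 4 * \<epsilon>"
    proof (rule ccontr)
      assume "\<not> ?thesis"
      hence big: "3 / 4 * \<epsilon> < G k" if "k \<le> n" for k using that by force
      have pos: "0 < G k" if "k \<le> n" for k using big[OF that] e by linarith
      have "a * real n \<le> 1 / G n"
        using a pos rec by (intro sublinear_recursion) auto
      also have "\<dots> < 1 / (3 / 4 * \<epsilon>)" using big[of n] e by (intro divide_strict_left_mono mult_pos_pos pos) auto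
      also have "\<dots> = a * (4 / (3 * \<epsilon> * a))" using a by simp
      also have "\<dots> \<le> a * real n" using n(1) a by (intro mult_left_mono) auto
      finally show False by simp
    qed
    then obtain k where k: "k \<le> n" "G k \<le> 3 / 4 * \<epsilon>" by blast
    have "eps_optimal P \<epsilon> (x k)"
      using eps_optimalI[OF \<epsilon> _ z(2)] inv[of k] k by (simp add: G_def)
    moreover have "4 / (3 * \<epsilon> * a) = 8 / (3 * c) / \<epsilon> ^ 5" by (simp add: a_def eval_nat_numeral)
    hence "real k \<le> 8 / (3 * c) / \<epsilon> ^ 5 + 1" using k(1) n(2) by linarith
    ultimately show "\<exists>k. eps_optimal P \<epsilon> (x k) \<and> real k \<le> 8 / (3 * c) / \<epsilon> ^ 5 + 1" by blast
  qed
qed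

end

end

section \<open>The smallest nonzero eigenvalue of the mixing matrix\<close>

text \<open>
  The expansion in an orthonormal basis of \<open>S\<close> defines a linear map with the two characteristic properties, and
  these determine the matrix.
\<close>

lemma orth_proj_matrix_works:
  assumes S: "subspace S"
  shows orth_proj_matrix_mem: "orth_proj_matrix S *v x \<in> S"
    and orth_proj_matrix_orthogonal: "y \<in> S \<Longrightarrow> (x - orth_proj_matrix S *v x) \<bullet> y = 0"
proof -
  let ?P = "\<lambda>M. \<forall>x. M *v x \<in> S \<and> (\<forall>y\<in>S. (x - M *v x) \<bullet> y = 0)"
  obtain B where B: "B \<subseteq> S" "pairwise orthogonal B" "\<And>x. x \<in> B \<Longrightarrow> norm x = 1"
    "independent B" "span B = S"
    using orthonormal_basis_subspace[OF S] by metis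
  have fin: "finite B" using B(4) by (rule independent_imp_finite)
  define f where "f x = (\<Sum>b\<in>B. (x \<bullet> b) *\<^sub>R b)" for x
  have "linear f"
    unfolding f_def
    by (rule linearI) (simp_all add: inner_add_left scaleR_add_left sum.distrib scaleR_sum_right)
  hence M: "matrix f *v x = f x" for x by (simp add: matrix_works)
  have "f x \<in> S" for x unfolding f_def using B(1) by (intro subspace_sum subspace_scale S) auto
  moreover have "(x - f x) \<bullet> y = 0" if "y \<in> S" for x y
  proof -
    have "x \<bullet> y = x \<bullet> (\<Sum>b\<in>B. (y \<bullet> b) *\<^sub>R b)"
      using orthonormal_basis_expand[OF B(2,3) _ fin, of y] that B(5) by simp
    also have "\<dots> = f x \<bullet> y" by (simp add: f_def inner_sum_left inner_sum_right inner_commute mult.commute)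
    finally show ?thesis by (simp add: inner_diff_left)
  qed
  ultimately have ex: "?P (matrix f)" by (simp add: M)
  have "M = N" if "?P M" "?P N" for M N
  proof -
    have "M *v x = N *v x" for x
    proof -
      have d: "M *v x - N *v x \<in> S" using that S by (simp add: subspace_diff)
      have "(x - N *v x) \<bullet> (M *v x - N *v x) - (x - M *v x) \<bullet> (M *v x - N *v x) = 0"
        using that d by simp
      hence "(M *v x - N *v x) \<bullet> (M *v x - N *v x) = 0" by (simp add: inner_diff_left[symmetric])
      thus ?thesis by simp
    qed
    thus ?thesis by (simp add: matrix_eq)
  qed
  with ex have "\<exists>!M. ?P M" by blast
  hence "?P (orth_proj_matrix S)" unfolding orth_proj_matrix_def by (rule theI')
  thus "orth_proj_matrix S *v x \<in> S" "y \<in> S \<Longrightarrow> (x - orth_proj_matrix S *v x) \<bullet> y = 0" by auto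
qed

lemma orth_proj_matrix_inner:
  assumes "subspace S"
  shows "(orth_proj_matrix S *v x) \<bullet> y = (orth_proj_matrix S *v x) \<bullet> (orth_proj_matrix S *v y)"
  using orth_proj_matrix_orthogonal[OF assms orth_proj_matrix_mem[OF assms], of y x]
  by (simp add: inner_diff_right inner_commute[of _ "orth_proj_matrix S *v x"])

lemma orth_proj_matrix_fixes:
  assumes S: "subspace S" and x: "x \<in> S"
  shows "orth_proj_matrix S *v x = x"
proof -
  have "(x - orth_proj_matrix S *v x) \<bullet> (x - orth_proj_matrix S *v x) = 0"
    by (intro orth_proj_matrix_orthogonal subspace_diff S x orth_proj_matrix_mem)
  thus ?thesis by simp
qed

lemma mixing_matrix_mult:
  fixes P :: "('v::finite, 'n::finite, 'm::finite) network_problem"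
  shows "mixing_matrix P *v x = (\<Sum>i\<in>UNIV. weight P i *\<^sub>R (orth_proj_matrix (reach_space P i) *v x))"
proof -
  have "(\<Sum>i\<in>I. M i) *v x = (\<Sum>i\<in>I. M i *v x)" if "finite I" for I and M :: "'v \<Rightarrow> real ^ 'n ^ 'n" and x
    using that by induction (auto simp: matrix_vector_mult_add_rdistrib)
  thus ?thesis by (simp add: mixing_matrix_def scaleR_matrix_vector_assoc)
qed

text \<open>
  The quadratic form of \<open>W\<close> at \<open>x\<close> is the sum of the \<open>\<eta>\<^sub>i |P\<^sub>i x|\<^sup>2\<close>.  If the null space of \<open>A\<close> is not trivial, some
  \<open>S\<^sub>i\<close> contains a vector \<open>u \<noteq> 0\<close>, at which the form is positive; so \<open>W\<close> has a nonzero eigenvalue, and the minimum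
  is taken over a finite nonempty set.
\<close>

lemma lambda_W_nonzero:
  fixes P :: "('v::finite, 'n::finite, 'm::finite) network_problem"
  assumes a2: "assumption2 P" and w: "coeff P *v w = 0" "w \<noteq> 0"
  shows "lambda_W P \<noteq> 0"
proof -
  let ?f = "\<lambda>x. mixing_matrix P *v x" and ?M = "\<lambda>i. orth_proj_matrix (reach_space P i)"
  have inner: "?f x \<bullet> y = (\<Sum>i\<in>UNIV. weight P i * ((?M i *v x) \<bullet> (?M i *v y)))" for x y
    by (simp add: mixing_matrix_mult inner_sum_left orth_proj_matrix_inner[OF subspace_reach_space, symmetric])
  have sym: "?f x \<bullet> y = x \<bullet> ?f y" for x y
    unfolding inner inner_commute[of x] by (simp add: inner_commute)
  obtain u where u: "w = (\<Sum>i\<in>UNIV. u i)" "\<And>i. u i \<in> reach_space P i"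
    using a2 w(1) unfolding assumption2_def by blast
  obtain i where i: "u i \<noteq> 0" using w(2) u(1) by (metis sum.neutral)
  have "0 < weight P i * ((?M i *v u i) \<bullet> (?M i *v u i))"
    using i weight_pos[of P i] by (simp add: orth_proj_matrix_fixes[OF subspace_reach_space u(2)])
  also have "\<dots> \<le> ?f (u i) \<bullet> u i"
    unfolding inner by (rule member_le_sum) (auto intro!: mult_nonneg_nonneg less_imp_le[OF weight_pos])
  finally obtain \<mu> v where "0 < \<mu>" "v \<noteq> 0" "?f v = \<mu> *\<^sub>R v"
    by (rule symmetric_positive_eigenvalue[of ?f, OF matrix_vector_mul_linear sym]) (rule that)
  hence "\<mu> \<noteq> 0" and "mat_eigenvalue (mixing_matrix P) \<mu>"
    unfolding mat_eigenvalue_def by blast+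
  hence "{\<mu>. \<mu> \<noteq> 0 \<and> mat_eigenvalue (mixing_matrix P) \<mu>} \<noteq> {}" by blast
  moreover have "finite {\<mu>. \<mu> \<noteq> 0 \<and> mat_eigenvalue (mixing_matrix P) \<mu>}"
    by (rule finite_subset[OF _ finite_symmetric_eigenvalues[of ?f, OF sym]]) (auto simp: mat_eigenvalue_def)
  ultimately show ?thesis unfolding lambda_W_def using Min_in by blast
qed

context barrier_dfm begin

text \<open>
  A positive gap provides a second feasible point.
\<close>

lemma lambda_W_nonzero_if_gap:
  assumes "0 < gap0"
  shows "lambda_W P \<noteq> 0"
proof -
  have "opt_value P < objective P x0" using assms by (simp add: gap0_def)
  then obtain y where y: "y \<in> feasible P" "objective P y < objective P x0"
    using assumption1 x0 bar_feasible_feasible unfolding opt_value_def assumption1_def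
    by (subst (asm) cINF_less_iff) auto
  have "coeff P *v (y - x0) = 0"
    using y(1) x0 by (simp add: matrix_vector_mult_diff_distrib feasible_def bar_feasible_def coeff_sum_blocks)
  moreover have "y - x0 \<noteq> 0" using y(2) by auto
  ultimately show ?thesis by (rule lambda_W_nonzero[OF assumption2])
qed

end

section \<open>The complexity bounds\<close>

lemma k_eps_le: "eps_optimal P \<epsilon> (x k) \<Longrightarrow> k_eps P x \<epsilon> \<le> k"
  unfolding k_eps_def by (rule Least_le)

lemma bigo_at_0_withinI:
  fixes f g :: "real \<Rightarrow> real"
  assumes "0 < d" "\<And>\<epsilon>. \<epsilon> \<in> S \<Longrightarrow> \<bar>\<epsilon>\<bar> < d \<Longrightarrow> \<bar>f \<epsilon>\<bar> \<le> c * \<bar>g \<epsilon>\<bar>"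
  shows "f \<in> O[at 0 within S](g)"
proof (rule bigoI)
  show "\<forall>\<^sub>F \<epsilon> in at 0 within S. norm (f \<epsilon>) \<le> c * norm (g \<epsilon>)"
    unfolding eventually_at using assms by (intro exI[of _ d]) (auto simp: dist_norm)
qed

theorem corollary1:
  fixes P :: "('v::finite, 'n::finite, 'm::finite) network_problem"
    and L :: "'v \<Rightarrow> real" and \<beta> \<beta>\<^sub>1 flow :: real
    and x0 :: "real ^ 'n" and x :: "real \<Rightarrow> nat \<Rightarrow> real ^ 'n"
  assumes "undirected_graph P"
    and "assumption1 P L \<beta> \<beta>\<^sub>1"
    and "assumption2 P"
    and "x0 \<in> bar_feasible P"
    and "barrier P x0 \<noteq> 0"
    and "flow \<le> opt_value P"
    and "\<And>\<epsilon>. \<epsilon> \<in> eps_range P x0 \<Longrightarrow> dfm_run P L (barrier_param P x0 flow \<epsilon>) x0 (x \<epsilon>)"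
  shows "((\<forall>i. convex_on (block_space P i) (loc_obj P i)) \<and>
          (\<forall>\<epsilon>\<in>eps_range P x0. compact {z \<in> bar_feasible P.
              bar_objective P (barrier_param P x0 flow \<epsilon>) z
                \<le> bar_objective P (barrier_param P x0 flow \<epsilon>) x0})
          \<longrightarrow> (\<forall>\<epsilon>\<in>eps_range P x0. \<exists>k. eps_optimal P \<epsilon> (x \<epsilon> k)) \<and>
              (\<lambda>\<epsilon>. real (k_eps P (x \<epsilon>) \<epsilon>))
                \<in> O[at 0 within eps_range P x0](\<lambda>\<epsilon>. 1 / (\<epsilon> ^ 5 * lambda_W P)))
       \<and> (\<forall>\<sigma>>0. (\<forall>i. strongly_convex_on (block_space P i) \<sigma> (loc_obj P i))
          \<longrightarrow> (\<forall>\<epsilon>\<in>eps_range P x0. \<exists>k. eps_optimal P \<epsilon> (x \<epsilon> k)) \<and>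
              (\<lambda>\<epsilon>. real (k_eps P (x \<epsilon>) \<epsilon>))
                \<in> O[at 0 within eps_range P x0](\<lambda>\<epsilon>. 1 / (\<sigma> * lambda_W P * \<epsilon> ^ 4) * ln (1 / \<epsilon>)))"
proof -
  interpret barrier_dfm P L \<beta> \<beta>\<^sub>1 x0 flow
    by unfold_locales (use assms in auto)
  show ?thesis
  proof (cases "0 < gap0")
    case False
    hence "eps_range P x0 = {}" by (auto simp: eps_range_def gap0_def)
    thus ?thesis by simp
  next
    case gap: True
    note e = eps_rangeD[OF gap]
    have \<lambda>: "lambda_W P \<noteq> 0" using lambda_W_nonzero_if_gap[OF gap] .
    have tangent0: "tangent_lower 0" if "\<forall>i. convex_on (block_space P i) (loc_obj P i)"
      using that convex_on_above_tangent[OF subspace_block_space loc_obj_diff] by (simp add: tangent_lower_def)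
    show ?thesis
    proof (intro conjI[of "_ \<longrightarrow> _"] impI allI)
      assume *: "(\<forall>i. convex_on (block_space P i) (loc_obj P i)) \<and>
          (\<forall>\<epsilon>\<in>eps_range P x0. compact {z \<in> bar_feasible P. F \<epsilon> z \<le> F \<epsilon> x0})"
      hence conv: "\<And>i. convex_on (block_space P i) (loc_obj P i)" by blast
      \<comment> \<open>compactness at this one accuracy bounds the distances for all the others\<close>
      have g: "gap0 \<in> eps_range P x0" using gap by (simp add: eps_range_def gap0_def)
      have "bounded {x \<in> feasible P. objective P x \<le> opt_value P + 3 * gap0}"
        using * g barrier_param_pos[OF gap g] gap
        by (intro bounded_objective_sublevel[OF conv, of "\<rho> gap0"]) (auto simp: gap0_def)
      then obtain C where C: "0 < C"
        "\<And>\<epsilon> x. \<epsilon> \<in> eps_range P x0 \<Longrightarrow> dfm_run P L (\<rho> \<epsilon>) x0 x \<Longrightarrow>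
            \<exists>k. eps_optimal P \<epsilon> (x k) \<and> real k \<le> C / \<epsilon> ^ 5 + 1"
        using sublinear_rate[OF gap tangent0 conv] conv by metis
      have ex: "\<exists>k. eps_optimal P \<epsilon> (x \<epsilon> k) \<and> real k \<le> C / \<epsilon> ^ 5 + 1" if "\<epsilon> \<in> eps_range P x0" for \<epsilon>
        using C(2)[OF that assms(7)[OF that]] .
      show "(\<forall>\<epsilon>\<in>eps_range P x0. \<exists>k. eps_optimal P \<epsilon> (x \<epsilon> k)) \<and>
              (\<lambda>\<epsilon>. real (k_eps P (x \<epsilon>) \<epsilon>))
                \<in> O[at 0 within eps_range P x0](\<lambda>\<epsilon>. 1 / (\<epsilon> ^ 5 * lambda_W P))"
      proof (intro conjI ballI)
        fix \<epsilon> assume "\<epsilon> \<in> eps_range P x0"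
        thus "\<exists>k. eps_optimal P \<epsilon> (x \<epsilon> k)" using ex by blast
      next
        show "(\<lambda>\<epsilon>. real (k_eps P (x \<epsilon>) \<epsilon>))
                \<in> O[at 0 within eps_range P x0](\<lambda>\<epsilon>. 1 / (\<epsilon> ^ 5 * lambda_W P))"
        proof (rule bigo_at_0_withinI[of 1 _ _ "(C + 1) * \<bar>lambda_W P\<bar>"])
          fix \<epsilon> assume \<epsilon>: "\<epsilon> \<in> eps_range P x0" "\<bar>\<epsilon>\<bar> < 1"
          obtain k where k: "eps_optimal P \<epsilon> (x \<epsilon> k)" "real k \<le> C / \<epsilon> ^ 5 + 1" using ex[OF \<epsilon>(1)] by blast
          have "1 \<le> 1 / \<epsilon> ^ 5" using e(1)[OF \<epsilon>(1)] \<epsilon>(2) by (simp add: power_le_one)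
          hence "real (k_eps P (x \<epsilon>) \<epsilon>) \<le> C / \<epsilon> ^ 5 + 1 / \<epsilon> ^ 5" using k k_eps_le[of P \<epsilon> "x \<epsilon>" k, OF k(1)] by linarith
          also have "\<dots> = (C + 1) * \<bar>lambda_W P\<bar> * \<bar>1 / (\<epsilon> ^ 5 * lambda_W P)\<bar>"
            using \<lambda> e(1)[OF \<epsilon>(1)] by (simp add: abs_mult field_simps)
          finally show "\<bar>real (k_eps P (x \<epsilon>) \<epsilon>)\<bar> \<le> (C + 1) * \<bar>lambda_W P\<bar> * \<bar>1 / (\<epsilon> ^ 5 * lambda_W P)\<bar>" by simp
        qed simp
      qed
    next
      fix \<sigma> :: real assume \<sigma>: "0 < \<sigma>" and sc: "\<forall>i. strongly_convex_on (block_space P i) \<sigma> (loc_obj P i)"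
      have conv: "\<And>i. convex_on (block_space P i) (loc_obj P i)"
        using sc by (simp add: strongly_convex_on_def)
      have tl: "tangent_lower \<sigma>"
        using strongly_convex_on_above_tangent[OF subspace_block_space loc_obj_diff] sc by (simp add: tangent_lower_def)
      obtain C where C: "0 < C"
        "\<And>\<epsilon> x. \<epsilon> \<in> eps_range P x0 \<Longrightarrow> dfm_run P L (\<rho> \<epsilon>) x0 x \<Longrightarrow>
            \<exists>k. eps_optimal P \<epsilon> (x k) \<and> real k \<le> C / \<epsilon> ^ 4 * ln (8 * gap0 / (3 * \<epsilon>)) + 1"
        using linear_rate[OF gap \<sigma> tl tangent0 conv] conv by metis
      have ex: "\<exists>k. eps_optimal P \<epsilon> (x \<epsilon> k) \<and> real k \<le> C / \<epsilon> ^ 4 * ln (8 * gap0 / (3 * \<epsilon>)) + 1"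
        if "\<epsilon> \<in> eps_range P x0" for \<epsilon>
        using C(2)[OF that assms(7)[OF that]] .
      show "(\<forall>\<epsilon>\<in>eps_range P x0. \<exists>k. eps_optimal P \<epsilon> (x \<epsilon> k)) \<and>
              (\<lambda>\<epsilon>. real (k_eps P (x \<epsilon>) \<epsilon>))
                \<in> O[at 0 within eps_range P x0](\<lambda>\<epsilon>. 1 / (\<sigma> * lambda_W P * \<epsilon> ^ 4) * ln (1 / \<epsilon>))"
      proof (intro conjI ballI)
        fix \<epsilon> assume "\<epsilon> \<in> eps_range P x0"
        thus "\<exists>k. eps_optimal P \<epsilon> (x \<epsilon> k)" using ex by blast
      next
        define K where "K = C * (1 + \<bar>ln (8 * gap0 / 3)\<bar>) + 1"
        show "(\<lambda>\<epsilon>. real (k_eps P (x \<epsilon>) \<epsilon>))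
                \<in> O[at 0 within eps_range P x0](\<lambda>\<epsilon>. 1 / (\<sigma> * lambda_W P * \<epsilon> ^ 4) * ln (1 / \<epsilon>))"
        proof (rule bigo_at_0_withinI[of "exp (- 1)" _ _ "K * \<sigma> * \<bar>lambda_W P\<bar>"])
          fix \<epsilon> :: real assume \<epsilon>: "\<epsilon> \<in> eps_range P x0" "\<bar>\<epsilon>\<bar> < exp (- 1)"
          note e0 = e(1)[OF \<epsilon>(1)]
          obtain k where k: "eps_optimal P \<epsilon> (x \<epsilon> k)" "real k \<le> C / \<epsilon> ^ 4 * ln (8 * gap0 / (3 * \<epsilon>)) + 1"
            using ex[OF \<epsilon>(1)] by blast
          have "\<epsilon> < exp (- 1)" using \<epsilon>(2) by simp
          hence "ln \<epsilon> < - 1" using e0 by (metis ln_exp ln_less_cancel_iff exp_gt_zero)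
          hence l: "1 \<le> ln (1 / \<epsilon>)" using e0 by (simp add: ln_div)
          have al: "\<bar>ln (1 / \<epsilon>)\<bar> = ln (1 / \<epsilon>)" using l by simp
          have "exp (- 1) \<le> (1 :: real)" by simp
          hence "\<epsilon> \<le> 1" using \<epsilon>(2) by linarith
          hence p: "1 \<le> 1 / \<epsilon> ^ 4" using e0 by (simp add: power_le_one)
          have "ln (8 * gap0 / (3 * \<epsilon>)) = ln (1 / \<epsilon>) + ln (8 * gap0 / 3)"
            using e0 gap by (simp add: ln_div ln_mult)
          also have "\<dots> \<le> ln (1 / \<epsilon>) + \<bar>ln (8 * gap0 / 3)\<bar> * ln (1 / \<epsilon>)"
            using mult_left_mono[OF l, of "\<bar>ln (8 * gap0 / 3)\<bar>"] by simp
          also have "\<dots> = (1 + \<bar>ln (8 * gap0 / 3)\<bar>) * ln (1 / \<epsilon>)" by (simp add: distrib_right)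
          finally have "C / \<epsilon> ^ 4 * ln (8 * gap0 / (3 * \<epsilon>)) \<le> C / \<epsilon> ^ 4 * ((1 + \<bar>ln (8 * gap0 / 3)\<bar>) * ln (1 / \<epsilon>))"
            using C(1) e0 by (intro mult_left_mono) auto
          moreover have "1 \<le> 1 / \<epsilon> ^ 4 * ln (1 / \<epsilon>)"
            using mult_mono[OF p l] p by simp
          ultimately have "real (k_eps P (x \<epsilon>) \<epsilon>)
              \<le> C / \<epsilon> ^ 4 * ((1 + \<bar>ln (8 * gap0 / 3)\<bar>) * ln (1 / \<epsilon>)) + 1 / \<epsilon> ^ 4 * ln (1 / \<epsilon>)"
            using k k_eps_le[of P \<epsilon> "x \<epsilon>" k, OF k(1)] by linarith
          also have "\<dots> = K * (ln (1 / \<epsilon>) / \<epsilon> ^ 4)"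
            by (simp add: K_def distrib_right mult.assoc add_divide_distrib)
          also have "\<dots> = K * \<sigma> * \<bar>lambda_W P\<bar> * \<bar>1 / (\<sigma> * lambda_W P * \<epsilon> ^ 4) * ln (1 / \<epsilon>)\<bar>"
            using \<lambda> \<sigma> e0 al by (simp add: abs_mult)
          finally show "\<bar>real (k_eps P (x \<epsilon>) \<epsilon>)\<bar>
              \<le> K * \<sigma> * \<bar>lambda_W P\<bar> * \<bar>1 / (\<sigma> * lambda_W P * \<epsilon> ^ 4) * ln (1 / \<epsilon>)\<bar>" by simp
        qed simp
      qed
    qed
  qed
qed

end
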